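(* Let $N\geqslant 1$ and let $(g,h)\in\exp\mathfrak t^0_3\times\exp\mathfrak t^0_{3,N}$ be a pair of group-like elements satisfying the mixed pentagon equation in $\exp\mathfrak t^0_{4,N}$: $$h\big(t^{12}\,|\,t(a)^{23}+t(a)^{24}\big)\; h\Big(t^{13}+\sum_{c}t(c)^{23}\,\Big|\,t(a)^{34}\Big)= g\big(t(0)^{23},t(0)^{34}\big)\; h\Big(t^{12}+t^{13}+\sum_{c}t(c)^{23}\,\Big|\,t(a)^{24}+t(a)^{34}\Big)\; h\big(t^{12}\,|\,t(a)^{23}\big),$$ where $c$ runs over $\mathbf Z/N\mathbf Z$. Then $h$ satisfies the distribution relation for $N'=1$ in $\exp\mathfrak t^0_3$: $$\pi_{N1}(h)=e^{\rho_{N1}(h)B}\,\delta_{N1}(h).$$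
   Context: Let $\mathbf k$ be a field of characteristic $0$. For $n\geqslant2$, $N\geqslant1$, $\mathfrak t_{n,N}$ is the completed (with respect to the grading where generators have degree 1) $\mathbf k$-Lie algebra with generators $t^{1i}$ ($2\leqslant i\leqslant n$) and $t(a)^{ij}$ ($i\ne j$, $2\leqslant i,j\leqslant n$, $a\in\mathbf Z/N\mathbf Z$) and relations, for all $a,b\in\mathbf Z/N\mathbf Z$ and all distinct $i,j,k,l\in\{2,\dots,n\}$: $t(a)^{ij}=t(-a)^{ji}$; $[t(a)^{ij},t(a+b)^{ik}+t(b)^{jk}]=0$; $[t^{1i}+t^{1j}+\sum_c t(c)^{ij},t(a)^{ij}]=0$; $[t^{1i},t^{1j}+\sum_c t(c)^{ij}]=0$; $[t^{1i},t(a)^{jk}]=0$; $[t(a)^{ij},t(b)^{kl}]=0$ (sums over $c\in\mathbf Z/N\mathbf Z$). $\mathfrak t^0_{n,N}\subset\mathfrak t_{n,N}$ is the (completed) Lie subalgebra generated by all these generators except $t^{1n}$. $\mathfrak t^0_{3,N}$ is the completed free Lie algebra on $A:=t^{12}$ and $B(a):=t(a)^{23}$ ($a\in\mathbf Z/N\mathbf Z$). For $N=1$ write $\mathfrak t_n=\mathfrak t_{n,1}$, $\mathfrak t^0_n=\mathfrak t^0_{n,1}$; $\mathfrak t^0_3$ is the completed free Lie algebra on $A=t^{12}$, $B=t^{23}$. $\exp\mathfrak g$ denotes the group of group-like elements (exponentials) in the completed enveloping algebra of $\mathfrak g$. For $g\in\exp\mathfrak t^0_3$, $g(X,Y)$ is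 the image of $g$ under $A\mapsto X$, $B\mapsto Y$; for $h\in\exp\mathfrak t^0_{3,N}$, $h(X\,|\,Y_a)$ is the image of $h$ under $A\mapsto X$, $B(a)\mapsto Y_a$ ($a\in\mathbf Z/N\mathbf Z$). $\pi_{N1},\delta_{N1}:\mathfrak t^0_{3,N}\to\mathfrak t^0_3$ are the Lie algebra morphisms $\pi_{N1}:A\mapsto NA,\ B(a)\mapsto B$ for all $a$; $\delta_{N1}:A\mapsto A,\ B(0)\mapsto B,\ B(a)\mapsto0$ for $a\neq0$; the same symbols denote the induced maps on group-like elements. $c_W(x)$ denotes the coefficient of the noncommutative monomial $W$ in $x$, and $\rho_{N1}(h)=c_{B}(\pi_{N1}(h))-c_{B(0)}(h)$. *)

theory Defs
  imports Complex_Main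
begin

section \<open>Noncommutative formal power series\<close>

text \<open>
  The algebra \<open>k\<langle>\<langle>X\<rangle>\<rangle>\<close>, an element being the family of its coefficients, indexed by words.
\<close>

typedef ('x, 'k) ncseries = "UNIV :: ('x list \<Rightarrow> 'k) set"
  morphisms coeff NCSeries ..

setup_lifting type_definition_ncseries

lemma ncseries_eqI: "(\<And>w. coeff f w = coeff g w) \<Longrightarrow> f = g"
  by (metis coeff_inject ext)

definition conv :: "('x list \<Rightarrow> 'k::comm_ring_1) \<Rightarrow> ('x list \<Rightarrow> 'k) \<Rightarrow> 'x list \<Rightarrow> 'k" where
  "conv f g w = (\<Sum>i\<le>length w. f (take i w) * g (drop i w))"

lemma conv_Nil: "conv f g [] = f [] * g []"
  by (simp add: conv_def)

lemma conv_Cons: "conv f g (x # w) = f [] * g (x # w) + conv (\<lambda>v. f (x # v)) g w"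
  by (simp add: conv_def sum.atMost_Suc_shift del: sum.atMost_Suc)

lemma conv_add_left: "conv (\<lambda>w. f w + f' w) g w = conv f g w + conv f' g w"
  by (simp add: conv_def sum.distrib distrib_right)

lemma conv_add_right: "conv f (\<lambda>w. g w + g' w) w = conv f g w + conv f g' w"
  by (simp add: conv_def sum.distrib distrib_left)

lemma conv_scale_left: "conv (\<lambda>w. c * f w) g w = c * conv f g w"
  by (simp add: conv_def sum_distrib_left mult.assoc)

lemma conv_zero_left: "conv (\<lambda>w. 0) g w = 0"
  by (simp add: conv_def)

lemma conv_assoc: "conv (conv f g) h w = conv f (conv g h) w"
proof (induction w arbitrary: f g)
  case Nil
  show ?case by (simp add: conv_Nil mult.assoc)
next
  case (Cons x w)
  have "conv (\<lambda>v. conv f g (x # v)) h w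
      = f [] * conv (\<lambda>v. g (x # v)) h w + conv (conv (\<lambda>v. f (x # v)) g) h w"
    by (simp add: conv_Cons conv_add_left conv_scale_left)
  then show ?case
    by (simp add: conv_Cons conv_Nil Cons.IH algebra_simps)
qed

lemma conv_one_left: "conv (\<lambda>w. if w = [] then 1 else 0) g w = g w"
  by (cases w) (simp_all add: conv_Nil conv_Cons conv_zero_left)

lemma conv_one_right: "conv f (\<lambda>w. if w = [] then 1 else 0) w = f w"
  by (induction w arbitrary: f) (simp_all add: conv_Nil conv_Cons)

instantiation ncseries :: (type, comm_ring_1) ring_1
begin

lift_definition zero_ncseries :: "('a, 'b) ncseries" is "\<lambda>w. 0" .
lift_definition one_ncseries :: "('a, 'b) ncseries" is "\<lambda>w. if w = [] then 1 else 0" .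
lift_definition plus_ncseries :: "('a, 'b) ncseries \<Rightarrow> ('a, 'b) ncseries \<Rightarrow> ('a, 'b) ncseries"
  is "\<lambda>f g w. f w + g w" .
lift_definition minus_ncseries :: "('a, 'b) ncseries \<Rightarrow> ('a, 'b) ncseries \<Rightarrow> ('a, 'b) ncseries"
  is "\<lambda>f g w. f w - g w" .
lift_definition uminus_ncseries :: "('a, 'b) ncseries \<Rightarrow> ('a, 'b) ncseries"
  is "\<lambda>f w. - f w" .
lift_definition times_ncseries :: "('a, 'b) ncseries \<Rightarrow> ('a, 'b) ncseries \<Rightarrow> ('a, 'b) ncseries"
  is conv .

instance
proof
  fix f g h :: "('a, 'b) ncseries"
  show "f * g * h = f * (g * h)"
    by transfer (rule ext, rule conv_assoc)
  show "(f + g) * h = f * h + g * h"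
    by transfer (rule ext, rule conv_add_left)
  show "f * (g + h) = f * g + f * h"
    by transfer (rule ext, rule conv_add_right)
  show "1 * f = f"
    by transfer (rule ext, rule conv_one_left)
  show "f * 1 = f"
    by transfer (rule ext, rule conv_one_right)
  show "(0::('a, 'b) ncseries) \<noteq> 1"
    by transfer (auto simp: fun_eq_iff)
qed (transfer, simp add: fun_eq_iff algebra_simps)+

end

lift_definition scale :: "'k::comm_ring_1 \<Rightarrow> ('x, 'k) ncseries \<Rightarrow> ('x, 'k) ncseries"
  is "\<lambda>c f w. c * f w" .

lift_definition letter :: "'x \<Rightarrow> ('x, 'k::comm_ring_1) ncseries"
  is "\<lambda>x w. if w = [x] then 1 else 0" .

lift_definition hom_part :: "nat \<Rightarrow> ('x, 'k::comm_ring_1) ncseries \<Rightarrow> ('x, 'k) ncseries"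
  is "\<lambda>d f w. if length w = d then f w else 0" .

text \<open>
  Continuous algebra morphism \<open>k\<langle>\<langle>X\<rangle>\<rangle> \<rightarrow> k\<langle>\<langle>Y\<rangle>\<rangle>\<close>, \<open>x \<mapsto> \<phi> x\<close>, for a finite alphabet \<open>X\<close>
  and series \<open>\<phi> x\<close> without constant term: then a word longer than \<open>v\<close>
  does not contribute to the coefficient of \<open>v\<close>, whence the finite sum.  The same
  remark applies to the exponential.
\<close>

definition subst :: "'x set \<Rightarrow> ('x \<Rightarrow> ('y, 'k::comm_ring_1) ncseries)
    \<Rightarrow> ('x, 'k) ncseries \<Rightarrow> ('y, 'k) ncseries" where
  "subst X \<phi> f = NCSeries (\<lambda>v. \<Sum>w | w \<in> lists X \<and> length w \<le> length v.
      coeff f w * coeff (prod_list (map \<phi> w)) v)"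

definition ncexp :: "('x, 'k::field_char_0) ncseries \<Rightarrow> ('x, 'k) ncseries" where
  "ncexp f = NCSeries (\<lambda>v. \<Sum>n\<le>length v. coeff (f ^ n) v / fact n)"

text \<open>
  Coefficient of \<open>u \<otimes> v\<close> in \<open>\<Delta>(f)\<close>, where \<open>\<Delta>\<close> is the continuous algebra morphism with
  \<open>\<Delta>(x) = x \<otimes> 1 + 1 \<otimes> x\<close> on letters; thus
  \<open>\<Delta>(x\<^sub>1\<dots>x\<^sub>m) = \<Sum>\<^sub>S x\<^sub>S \<otimes> x\<^sub>S\<^sub>'\<close>, \<open>S\<close> running over the subsets of the set of positions
  and \<open>S'\<close> being the complement of \<open>S\<close>.
\<close>

definition coproduct :: "'x set \<Rightarrow> ('x, 'k::comm_ring_1) ncseries \<Rightarrow> 'x list \<Rightarrow> 'x list \<Rightarrow> 'k" where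
  "coproduct X f u v = (\<Sum>w | w \<in> lists X \<and> length w = length u + length v.
      coeff f w * of_nat (card {S. S \<subseteq> {..<length w} \<and>
        nths w S = u \<and> nths w ({..<length w} - S) = v}))"

text \<open>
  For a finite set \<open>X\<close>, the completed enveloping algebra of the completed free Lie algebra on
  \<open>X\<close> is \<open>k\<langle>\<langle>X\<rangle>\<rangle>\<close>; this is the set of its group-like elements.
\<close>

definition exp_free_lie :: "'x set \<Rightarrow> ('x, 'k::field_char_0) ncseries set" where
  "exp_free_lie X = {f. (\<forall>w. coeff f w \<noteq> 0 \<longrightarrow> w \<in> lists X) \<and> coeff f [] = 1 \<and>
      (\<forall>u v. coproduct X f u v = coeff f u * coeff f v)}"


section \<open>Lie algebras given by generators and relations\<close>

record ('k, 'g) lie_alg =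
  lcarrier :: "'g set"
  lzero :: 'g
  ladd :: "'g \<Rightarrow> 'g \<Rightarrow> 'g"
  lscale :: "'k \<Rightarrow> 'g \<Rightarrow> 'g"
  lbracket :: "'g \<Rightarrow> 'g \<Rightarrow> 'g"

inductive_set lie_generated :: "('k, 'g) lie_alg \<Rightarrow> 'g set \<Rightarrow> 'g set"
  for L :: "('k, 'g) lie_alg" and S :: "'g set" where
  gen: "x \<in> S \<Longrightarrow> x \<in> lie_generated L S"
| zero: "lzero L \<in> lie_generated L S"
| add: "x \<in> lie_generated L S \<Longrightarrow> y \<in> lie_generated L S \<Longrightarrow> ladd L x y \<in> lie_generated L S"
| scale: "x \<in> lie_generated L S \<Longrightarrow> lscale L c x \<in> lie_generated L S"
| bracket: "x \<in> lie_generated L S \<Longrightarrow> y \<in> lie_generated L S \<Longrightarrow>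
    lbracket L x y \<in> lie_generated L S"

definition lie_subalgebra :: "('k, 'g) lie_alg \<Rightarrow> 'g set \<Rightarrow> ('k, 'g) lie_alg" where
  "lie_subalgebra L S = L\<lparr>lcarrier := lie_generated L S\<rparr>"

inductive_set lie_ideal :: "('k, 'g) lie_alg \<Rightarrow> 'g set \<Rightarrow> 'g set"
  for L :: "('k, 'g) lie_alg" and R :: "'g set" where
  rel: "r \<in> R \<Longrightarrow> r \<in> lie_ideal L R"
| zero: "lzero L \<in> lie_ideal L R"
| add: "x \<in> lie_ideal L R \<Longrightarrow> y \<in> lie_ideal L R \<Longrightarrow> ladd L x y \<in> lie_ideal L R"
| scale: "x \<in> lie_ideal L R \<Longrightarrow> lscale L c x \<in> lie_ideal L R"
| bracket: "x \<in> lie_ideal L R \<Longrightarrow> y \<in> lcarrier L \<Longrightarrow> lbracket L x y \<in> lie_ideal L R"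

definition lcoset :: "('k, 'g) lie_alg \<Rightarrow> 'g set \<Rightarrow> 'g \<Rightarrow> 'g set" where
  "lcoset L J x = ladd L x ` J"

definition lie_quotient :: "('k, 'g) lie_alg \<Rightarrow> 'g set \<Rightarrow> ('k, 'g set) lie_alg" where
  "lie_quotient L J = \<lparr>
     lcarrier = lcoset L J ` lcarrier L,
     lzero = lcoset L J (lzero L),
     ladd = (\<lambda>P Q. \<Union>x\<in>P. \<Union>y\<in>Q. lcoset L J (ladd L x y)),
     lscale = (\<lambda>c P. \<Union>x\<in>P. lcoset L J (lscale L c x)),
     lbracket = (\<lambda>P Q. \<Union>x\<in>P. \<Union>y\<in>Q. lcoset L J (lbracket L x y))\<rparr>"

definition commutator :: "'a::ring \<Rightarrow> 'a \<Rightarrow> 'a" where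
  "commutator x y = x * y - y * x"

definition ncseries_lie :: "('k::comm_ring_1, ('x, 'k) ncseries) lie_alg" where
  "ncseries_lie = \<lparr>lcarrier = UNIV, lzero = 0, ladd = (+), lscale = scale, lbracket = commutator\<rparr>"

text \<open>The free Lie algebra on \<open>X\<close>, realised by the Lie polynomials.\<close>

definition free_lie :: "'x set \<Rightarrow> ('k::field_char_0, ('x, 'k) ncseries) lie_alg" where
  "free_lie X = lie_subalgebra ncseries_lie (letter ` X)"

definition presented_lie :: "'x set \<Rightarrow> ('x, 'k::field_char_0) ncseries set
    \<Rightarrow> ('k, ('x, 'k) ncseries set) lie_alg" where
  "presented_lie X R = lie_quotient (free_lie X) (lie_ideal (free_lie X) R)"


section \<open>Enveloping algebras\<close>

text \<open>
  The enveloping algebra of \<open>L\<close> is the free associative algebra on the set \<open>lcarrier L\<close> modulo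
  the two-sided ideal generated by \<open>[x + y] - [x] - [y]\<close>, \<open>[c x] - c [x]\<close> and
  \<open>[x][y] - [y][x] - [[x, y]]\<close>.
\<close>

inductive_set uea_ideal :: "('k::comm_ring_1, 'g) lie_alg \<Rightarrow> ('g, 'k) ncseries set"
  for L :: "('k::comm_ring_1, 'g) lie_alg" where
  rel_add: "x \<in> lcarrier L \<Longrightarrow> y \<in> lcarrier L \<Longrightarrow>
    letter (ladd L x y) - letter x - letter y \<in> uea_ideal L"
| rel_scale: "x \<in> lcarrier L \<Longrightarrow> letter (lscale L c x) - scale c (letter x) \<in> uea_ideal L"
| rel_bracket: "x \<in> lcarrier L \<Longrightarrow> y \<in> lcarrier L \<Longrightarrow>
    commutator (letter x) (letter y) - letter (lbracket L x y) \<in> uea_ideal L"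
| zero: "0 \<in> uea_ideal L"
| add: "p \<in> uea_ideal L \<Longrightarrow> q \<in> uea_ideal L \<Longrightarrow> p + q \<in> uea_ideal L"
| scale: "p \<in> uea_ideal L \<Longrightarrow> scale c p \<in> uea_ideal L"
| mult_left: "x \<in> lcarrier L \<Longrightarrow> p \<in> uea_ideal L \<Longrightarrow> letter x * p \<in> uea_ideal L"
| mult_right: "x \<in> lcarrier L \<Longrightarrow> p \<in> uea_ideal L \<Longrightarrow> p * letter x \<in> uea_ideal L"

text \<open>
  Equality in the completed enveloping algebra of a Lie algebra \<open>L\<close> generated in degree 1.
  That algebra is \<open>\<Prod>\<^sub>d U(L)\<^sub>d\<close>, so two elements are equal iff their components of every degree
  agree in \<open>U(L)\<close>.  Elements are given by series in letters which are \<^emph>\<open>degree 1\<close> elements of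
  \<open>L\<close>, with finitely many terms of each length: for such a series the part of word length \<open>d\<close>
  represents the component of degree \<open>d\<close>.
\<close>

definition cuea_eq :: "('k::comm_ring_1, 'g) lie_alg
    \<Rightarrow> ('g, 'k) ncseries \<Rightarrow> ('g, 'k) ncseries \<Rightarrow> bool" where
  "cuea_eq L P Q \<longleftrightarrow> (\<forall>d. hom_part d P - hom_part d Q \<in> uea_ideal L)"


section \<open>The Lie algebras \<open>t\<close> and \<open>t\<^sup>0\<close>\<close>

text \<open>
  \<open>Z/NZ\<close> is represented by the residues \<open>0, \<dots>, N - 1\<close>.  \<open>T1 i\<close> stands for \<open>t\<^sup>1\<^sup>i\<close> and
  \<open>T a i j\<close> for \<open>t(a)\<^sup>i\<^sup>j\<close>.
\<close>

definition residues_mod :: "nat \<Rightarrow> int set" where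
  "residues_mod N = {0..<int N}"

datatype gen = T1 nat | T int nat nat

definition gens :: "nat \<Rightarrow> nat \<Rightarrow> gen set" where
  "gens n N = {T1 i | i. i \<in> {2..n}} \<union>
     {T a i j | a i j. a \<in> residues_mod N \<and> i \<in> {2..n} \<and> j \<in> {2..n} \<and> i \<noteq> j}"

abbreviation t1 :: "nat \<Rightarrow> (gen, 'k::field_char_0) ncseries" where
  "t1 i \<equiv> letter (T1 i)"

abbreviation t :: "int \<Rightarrow> nat \<Rightarrow> nat \<Rightarrow> (gen, 'k::field_char_0) ncseries" where
  "t a i j \<equiv> letter (T a i j)"

definition tsum :: "nat \<Rightarrow> nat \<Rightarrow> nat \<Rightarrow> (gen, 'k::field_char_0) ncseries" where
  "tsum N i j = (\<Sum>c\<in>residues_mod N. t c i j)"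

inductive_set relators :: "nat \<Rightarrow> nat \<Rightarrow> (gen, 'k::field_char_0) ncseries set"
  for n N :: nat where
  "\<lbrakk>a \<in> residues_mod N; {i, j} \<subseteq> {2..n}; distinct [i, j]\<rbrakk> \<Longrightarrow>
    t a i j - t ((- a) mod int N) j i \<in> relators n N"
| "\<lbrakk>a \<in> residues_mod N; b \<in> residues_mod N; {i, j, k} \<subseteq> {2..n}; distinct [i, j, k]\<rbrakk> \<Longrightarrow>
    commutator (t a i j) (t ((a + b) mod int N) i k + t b j k) \<in> relators n N"
| "\<lbrakk>a \<in> residues_mod N; {i, j} \<subseteq> {2..n}; distinct [i, j]\<rbrakk> \<Longrightarrow>
    commutator (t1 i + t1 j + tsum N i j) (t a i j) \<in> relators n N"
| "\<lbrakk>{i, j} \<subseteq> {2..n}; distinct [i, j]\<rbrakk> \<Longrightarrow>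
    commutator (t1 i) (t1 j + tsum N i j) \<in> relators n N"
| "\<lbrakk>a \<in> residues_mod N; {i, j, k} \<subseteq> {2..n}; distinct [i, j, k]\<rbrakk> \<Longrightarrow>
    commutator (t1 i) (t a j k) \<in> relators n N"
| "\<lbrakk>a \<in> residues_mod N; b \<in> residues_mod N; {i, j, k, l} \<subseteq> {2..n}; distinct [i, j, k, l]\<rbrakk> \<Longrightarrow>
    commutator (t a i j) (t b k l) \<in> relators n N"

text \<open>
  \<open>lie_t n N\<close> and \<open>lie_t0 n N\<close> are the graded Lie algebras whose degree completions are
  \<open>t\<^sub>n\<^sub>,\<^sub>N\<close> and \<open>t\<^sup>0\<^sub>n\<^sub>,\<^sub>N\<close>; the completion is performed on enveloping algebras,
  by \<^const>\<open>cuea_eq\<close>.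
\<close>

definition lie_t :: "nat \<Rightarrow> nat \<Rightarrow> ('k::field_char_0, (gen, 'k) ncseries set) lie_alg" where
  "lie_t n N = presented_lie (gens n N) (relators n N)"

definition cls :: "nat \<Rightarrow> nat \<Rightarrow> (gen, 'k::field_char_0) ncseries \<Rightarrow> (gen, 'k) ncseries set" where
  "cls n N = lcoset (free_lie (gens n N)) (lie_ideal (free_lie (gens n N)) (relators n N))"

definition lie_t0 :: "nat \<Rightarrow> nat \<Rightarrow> ('k::field_char_0, (gen, 'k) ncseries set) lie_alg" where
  "lie_t0 n N = lie_subalgebra (lie_t n N) ((\<lambda>x. cls n N (letter x)) ` (gens n N - {T1 n}))"


section \<open>The groups \<open>exp t\<^sup>0\<^sub>3\<^sub>,\<^sub>N\<close>\<close>

text \<open>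
  The generators \<open>A\<close>, \<open>B(a)\<close> of the free Lie algebra \<open>t\<^sup>0\<^sub>3\<^sub>,\<^sub>N\<close>.  The case \<open>N = 1\<close> gives
  \<open>t\<^sup>0\<^sub>3\<close>, whose generator \<open>B\<close> is thus \<open>B 0\<close>.
\<close>

datatype gen3 = A | B int

definition gens3 :: "nat \<Rightarrow> gen3 set" where
  "gens3 N = {A} \<union> B ` residues_mod N"

definition exp_t03 :: "nat \<Rightarrow> (gen3, 'k::field_char_0) ncseries set" where
  "exp_t03 N = exp_free_lie (gens3 N)"

text \<open>
  \<open>ev N h X Y\<close> is \<open>h(X | Y\<^sub>a)\<close> for \<open>X\<close>, \<open>Y\<^sub>a\<close> in a Lie algebra \<open>L\<close>, as a series in letters from
  \<open>L\<close>.
\<close>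

definition ev :: "nat \<Rightarrow> (gen3, 'k::field_char_0) ncseries \<Rightarrow> 'g \<Rightarrow> (int \<Rightarrow> 'g) \<Rightarrow> ('g, 'k) ncseries" where
  "ev N h X Y = subst (gens3 N) (\<lambda>s. case s of A \<Rightarrow> letter X | B a \<Rightarrow> letter (Y a)) h"

definition pi_N1 :: "nat \<Rightarrow> (gen3, 'k::field_char_0) ncseries \<Rightarrow> (gen3, 'k) ncseries" where
  "pi_N1 N = subst (gens3 N)
     (\<lambda>s. case s of A \<Rightarrow> scale (of_nat N) (letter A) | B a \<Rightarrow> letter (B 0))"

definition delta_N1 :: "nat \<Rightarrow> (gen3, 'k::field_char_0) ncseries \<Rightarrow> (gen3, 'k) ncseries" where
  "delta_N1 N = subst (gens3 N)
     (\<lambda>s. case s of A \<Rightarrow> letter A | B a \<Rightarrow> if a = 0 then letter (B 0) else 0)"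

definition rho_N1 :: "nat \<Rightarrow> (gen3, 'k::field_char_0) ncseries \<Rightarrow> 'k" where
  "rho_N1 N h = coeff (pi_N1 N h) [B 0] - coeff h [B 0]"

end

theory Submission
  imports Defs
begin

text \<open>
  For a subgroup \<open>E\<close> of \<open>Z/NZ\<close> let \<open>h\<^sub>E\<close> be the image of \<open>h\<close> under \<open>A \<mapsto> |E| A\<close>, \<open>B(a) \<mapsto> B\<close> for
  \<open>a \<in> E\<close>, \<open>B(a) \<mapsto> 0\<close> for \<open>a \<notin> E\<close>; thus \<open>\<pi>\<^sub>N\<^sub>1(h)\<close> and \<open>\<delta>\<^sub>N\<^sub>1(h)\<close> are the cases \<open>E = Z/NZ\<close> and
  \<open>E = {0}\<close>.  Apply to the mixed pentagon the morphism killing all \<open>t\<^sup>1\<^sup>i\<close> and the \<open>t(a)\<^sup>i\<^sup>j\<close> with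
  \<open>a \<notin> E\<close>, and sending the other \<open>t(a)\<^sup>2\<^sup>3\<close>, \<open>t(a)\<^sup>3\<^sup>4\<close>, \<open>t(a)\<^sup>2\<^sup>4\<close> to \<open>A\<close>, \<open>B\<close>, \<open>- A - B\<close>.  Every factor
  except \<open>h\<^sub>E\<close> and \<open>g\<close> becomes a group-like series evaluated at multiples of a single letter,
  hence an exponential.  As \<open>h\<close> has no linear term in \<open>A\<close>, by the image of the equation under
  \<open>t\<^sup>1\<^sup>2 \<mapsto> A\<close> (all other generators to \<open>0\<close>), there remains \<open>h\<^sub>E = e\<^bsup>c\<^sub>E B\<^esup> g\<close> with \<open>c\<^sub>E\<close> the sum of
  the \<open>c\<^bsub>B(a)\<^esub>(h)\<close> over \<open>a \<in> E\<close>.  Comparing the two choices of \<open>E\<close> eliminates \<open>g\<close>.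
\<close>

section \<open>Series and substitutions\<close>

lemma coeff_NCSeries [simp]: "coeff (NCSeries F) = F"
  by (simp add: NCSeries_inverse)

lemma coeff_zero [simp]: "coeff 0 w = 0"
  by transfer simp

lemma coeff_one: "coeff 1 w = (if w = [] then 1 else 0)"
  by transfer simp

lemma coeff_add [simp]: "coeff (f + g) w = coeff f w + coeff g w"
  by transfer simp

lemma coeff_diff [simp]: "coeff (f - g) w = coeff f w - coeff g w"
  by transfer simp

lemma coeff_uminus [simp]: "coeff (- f) w = - coeff f w"
  by transfer simp

lemma coeff_scale [simp]: "coeff (scale c f) w = c * coeff f w"
  by transfer simp

lemma coeff_letter: "coeff (letter x) w = (if w = [x] then 1 else 0)"
  by transfer simp

lemma coeff_hom_part: "coeff (hom_part d f) w = (if length w = d then coeff f w else 0)"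
  by transfer simp

lemma coeff_mult: "coeff (f * g) w = (\<Sum>i\<le>length w. coeff f (take i w) * coeff g (drop i w))"
  by transfer (simp add: conv_def)

lemma coeff_mult_Nil [simp]: "coeff (f * g) [] = coeff f [] * coeff g []"
  by (simp add: coeff_mult)

lemma coeff_mult_singleton: "coeff (f * g) [x] = coeff f [] * coeff g [x] + coeff f [x] * coeff g []"
  by (simp add: coeff_mult)

lemma scale_mult_left: "scale c f * g = scale c (f * g)"
  by (rule ncseries_eqI) (simp add: coeff_mult sum_distrib_left mult.assoc)

lemma scale_mult_right: "f * scale c g = scale c (f * g)"
  by (rule ncseries_eqI) (simp add: coeff_mult sum_distrib_left mult.left_commute)

lemma scale_scale: "scale a (scale b f) = scale (a * b) f"
  by (rule ncseries_eqI) (simp add: mult.assoc)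

lemma scale_0 [simp]: "scale 0 f = 0" "scale c 0 = 0"
  by (rule ncseries_eqI, simp)+

lemma scale_1 [simp]: "scale 1 f = f"
  by (rule ncseries_eqI) simp

lemma scale_minus_1: "scale (- 1) f = - f"
  by (rule ncseries_eqI) simp

lemma sum_if_const_eq_scale:
  assumes "finite S"
  shows "(\<Sum>c\<in>S. if c \<in> E then f else 0) = scale (of_nat (card (S \<inter> E))) f"
  using assms
  by (induction S) (auto simp: Int_insert_left intro!: ncseries_eqI simp: algebra_simps)

section \<open>Supports of series and homogeneity of degree 1\<close>

text \<open>The type of series fixes no finite alphabet, and \<open>subst X\<close> discards every
  word with a letter outside \<open>X\<close>; changing or removing the alphabet of a substitution
  therefore requires this condition.\<close>

definition supported :: "'x set \<Rightarrow> ('x, 'k::comm_ring_1) ncseries \<Rightarrow> bool" where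
  "supported X f \<longleftrightarrow> (\<forall>w. coeff f w \<noteq> 0 \<longrightarrow> w \<in> lists X)"

text \<open>Homogeneity of degree 1, zero included: the shape of the images of generators under
  graded morphisms.\<close>

definition linear_form :: "('x, 'k::comm_ring_1) ncseries \<Rightarrow> bool" where
  "linear_form f \<longleftrightarrow> (\<forall>w. coeff f w \<noteq> 0 \<longrightarrow> length w = 1)"

lemma linear_form_const: "linear_form f \<Longrightarrow> coeff f [] = 0"
  by (auto simp: linear_form_def)

lemma linear_form_simps [simp]:
  "linear_form 0" "linear_form (letter x)"
  "linear_form f \<Longrightarrow> linear_form (scale c f)"
  "linear_form f \<Longrightarrow> linear_form (- f)"
  "linear_form f \<Longrightarrow> linear_form g \<Longrightarrow> linear_form (f + g)"
  "linear_form f \<Longrightarrow> linear_form g \<Longrightarrow> linear_form (f - g)"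
proof -
  show "linear_form f \<Longrightarrow> linear_form g \<Longrightarrow> linear_form (f + g)"
    unfolding linear_form_def coeff_add by (metis add.right_neutral)
  show "linear_form f \<Longrightarrow> linear_form g \<Longrightarrow> linear_form (f - g)"
    unfolding linear_form_def coeff_diff by (metis diff_self)
  show "linear_form f \<Longrightarrow> linear_form (scale c f)"
    unfolding linear_form_def coeff_scale by (metis mult_zero_right)
qed (auto simp: linear_form_def coeff_letter)

lemma linear_form_sum: "(\<And>x. x \<in> S \<Longrightarrow> linear_form (f x)) \<Longrightarrow> linear_form (sum f S)"
  by (induction S rule: infinite_finite_induct) auto

lemma supported_mult:
  assumes "supported X f" "supported X g"
  shows "supported X (f * g)"
  unfolding supported_def
proof (intro allI impI)
  fix w assume "coeff (f * g) w \<noteq> 0"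
  then obtain i where "coeff f (take i w) * coeff g (drop i w) \<noteq> 0"
    unfolding coeff_mult by (meson sum.not_neutral_contains_not_neutral)
  then have "coeff f (take i w) \<noteq> 0" "coeff g (drop i w) \<noteq> 0" by auto
  then have "take i w \<in> lists X" "drop i w \<in> lists X"
    using assms by (auto simp: supported_def)
  then show "w \<in> lists X" by (metis append_in_lists_conv append_take_drop_id)
qed

lemma supported_one: "supported X 1"
  by (auto simp: supported_def coeff_one)

lemma supported_letter: "x \<in> X \<Longrightarrow> supported X (letter x)"
  by (auto simp: supported_def coeff_letter)

lemma supported_hom_part: "supported X f \<Longrightarrow> supported X (hom_part d f)"
  by (auto simp: supported_def coeff_hom_part)

lemma supported_prod_list: "(\<And>f. f \<in> set fs \<Longrightarrow> supported X f) \<Longrightarrow> supported X (prod_list fs)"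
  by (induction fs) (auto simp: supported_one intro: supported_mult)

lemma supported_subst:
  assumes "\<And>x. x \<in> X \<Longrightarrow> supported Y (\<phi> x)"
  shows "supported Y (subst X \<phi> f)"
  unfolding supported_def
proof (intro allI impI)
  fix v assume "coeff (subst X \<phi> f) v \<noteq> 0"
  then obtain w where w: "w \<in> lists X" "coeff f w * coeff (prod_list (map \<phi> w)) v \<noteq> 0"
    unfolding subst_def coeff_NCSeries
    by (smt (verit, best) mem_Collect_eq sum.neutral)
  moreover have "supported Y (prod_list (map \<phi> w))"
    using w(1) assms by (intro supported_prod_list) auto
  ultimately show "v \<in> lists Y" unfolding supported_def by (metis mult_zero_right)
qed

section \<open>Coefficients of substituted series\<close>

lemma finite_words: "finite X \<Longrightarrow> finite {w. w \<in> lists X \<and> length w \<le> n}"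
  using finite_lists_length_le[of X n] by (simp add: lists_eq_set)

lemma finite_words_eq: "finite X \<Longrightarrow> finite {w. w \<in> lists X \<and> length w = n}"
  using finite_lists_length_eq[of X n] by (simp add: lists_eq_set)

text \<open>Each factor uses up at least one letter, so the product begins in degree
  \<open>length fs\<close> at the earliest.\<close>

lemma coeff_prod_list_short:
  assumes "\<And>f. f \<in> set fs \<Longrightarrow> coeff f [] = 0" "length v < length fs"
  shows "coeff (prod_list fs) v = 0"
  using assms
proof (induction fs arbitrary: v)
  case (Cons f fs)
  have "coeff f (take i v) * coeff (prod_list fs) (drop i v) = 0" if "i \<le> length v" for i
  proof (cases i)
    case (Suc j)
    then have "length (drop i v) < length fs" using that Cons.prems(2) by auto
    then show ?thesis using Cons.IH Cons.prems(1) by simp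
  qed (use Cons.prems(1) in simp)
  then show ?case by (simp add: coeff_mult)
qed auto

text \<open>The words added when the bound grows from \<open>length v\<close> to \<open>n\<close>
  contribute 0. A single range of summation then serves for all words of length at most
  \<open>n\<close>.\<close>

lemma coeff_subst:
  assumes "finite X" "\<And>x. x \<in> X \<Longrightarrow> coeff (\<phi> x) [] = 0" "length v \<le> n"
  shows "coeff (subst X \<phi> f) v =
    (\<Sum>w | w \<in> lists X \<and> length w \<le> n. coeff f w * coeff (prod_list (map \<phi> w)) v)"
  unfolding subst_def coeff_NCSeries
proof (rule sum.mono_neutral_left)
  show "\<forall>w\<in>{w \<in> lists X. length w \<le> n} - {w \<in> lists X. length w \<le> length v}.
      coeff f w * coeff (prod_list (map \<phi> w)) v = 0"
  proof
    fix w assume w: "w \<in> {w \<in> lists X. length w \<le> n} - {w \<in> lists X. length w \<le> length v}"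
    have "coeff (prod_list (map \<phi> w)) v = 0"
      by (rule coeff_prod_list_short) (use w assms(2) in auto)
    then show "coeff f w * coeff (prod_list (map \<phi> w)) v = 0" by simp
  qed
qed (use assms finite_words in auto)

lemma coeff_subst_Nil [simp]: "coeff (subst X \<phi> f) [] = coeff f []"
proof -
  have "{w. w \<in> lists X \<and> length w \<le> 0} = {[]}" by auto
  then show ?thesis by (simp add: subst_def coeff_one)
qed

lemma coeff_subst_singleton:
  assumes "finite X"
  shows "coeff (subst X \<phi> f) [y] = (\<Sum>x\<in>X. coeff f [x] * coeff (\<phi> x) [y])"
proof -
  have eq: "{w. w \<in> lists X \<and> length w \<le> length [y]} = insert [] ((\<lambda>x. [x]) ` X)"
    by (auto simp: le_Suc_eq length_Suc_conv)
  show ?thesis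
    unfolding subst_def coeff_NCSeries eq using assms
    by (simp add: coeff_one sum.reindex inj_on_def image_iff)
qed

lemma subst_cong:
  assumes "\<And>x. x \<in> X \<Longrightarrow> \<phi> x = \<psi> x"
  shows "subst X \<phi> f = subst X \<psi> f"
proof -
  have eq: "map \<phi> w = map \<psi> w" if "w \<in> lists X" for w
    using that assms by auto
  show ?thesis
    unfolding subst_def by (intro arg_cong[where f = NCSeries] ext sum.cong) (simp_all add: eq del: in_lists_conv_set map_eq_conv)
qed

section \<open>Substitutions as algebra morphisms, and their composition\<close>

lemma subst_add: "subst X \<phi> (f + g) = subst X \<phi> f + subst X \<phi> g"
  by (rule ncseries_eqI) (simp add: subst_def distrib_right sum.distrib)

lemma subst_diff: "subst X \<phi> (f - g) = subst X \<phi> f - subst X \<phi> g"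
  by (rule ncseries_eqI) (simp add: subst_def left_diff_distrib sum_subtractf)

lemma subst_scale: "subst X \<phi> (scale c f) = scale c (subst X \<phi> f)"
  by (rule ncseries_eqI) (simp add: subst_def sum_distrib_left mult.assoc)

lemma subst_zero [simp]: "subst X \<phi> 0 = 0"
  by (rule ncseries_eqI) (simp add: subst_def)

lemma subst_sum: "subst X \<phi> (sum f S) = (\<Sum>s\<in>S. subst X \<phi> (f s))"
  by (induction S rule: infinite_finite_induct) (auto simp: subst_add)

lemma subst_one [simp]:
  assumes "finite X"
  shows "subst X \<phi> 1 = 1"
proof (rule ncseries_eqI)
  fix v
  have "coeff (subst X \<phi> 1) v = (\<Sum>w | w \<in> lists X \<and> length w \<le> length v.
      if w = [] then coeff (prod_list (map \<phi> w)) v else 0)"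
    unfolding subst_def coeff_NCSeries by (intro sum.cong) (auto simp: coeff_one)
  also have "\<dots> = coeff 1 v"
    by (subst sum.delta) (use finite_words[OF assms] in auto)
  finally show "coeff (subst X \<phi> 1) v = coeff 1 v" .
qed

lemma subst_letter:
  assumes "finite X" "x \<in> X" "coeff (\<phi> x) [] = 0"
  shows "subst X \<phi> (letter x) = \<phi> x"
proof (rule ncseries_eqI)
  fix v
  have "coeff (subst X \<phi> (letter x)) v = (\<Sum>w | w \<in> lists X \<and> length w \<le> length v.
      if w = [x] then coeff (prod_list (map \<phi> w)) v else 0)"
    unfolding subst_def coeff_NCSeries by (intro sum.cong) (auto simp: coeff_letter)
  also have "\<dots> = coeff (\<phi> x) v"
    by (subst sum.delta) (use finite_words[OF assms(1)] assms in \<open>auto simp: Suc_le_eq\<close>)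
  finally show "coeff (subst X \<phi> (letter x)) v = coeff (\<phi> x) v" .
qed

lemma subst_mult:
  fixes \<phi> :: "'x \<Rightarrow> ('y, 'k::comm_ring_1) ncseries"
  assumes "finite X" "\<And>x. x \<in> X \<Longrightarrow> coeff (\<phi> x) [] = 0"
  shows "subst X \<phi> (f * g) = subst X \<phi> f * subst X \<phi> g"
proof (rule ncseries_eqI)
  fix v :: "'y list"
  define L where "L = {w. w \<in> lists X \<and> length w \<le> length v}"
  define p where "p w = prod_list (map \<phi> w)" for w
  have fin: "finite L" unfolding L_def by (rule finite_words) fact
  have cs: "coeff (subst X \<phi> k) u = (\<Sum>w\<in>L. coeff k w * coeff (p w) u)" if "length u \<le> length v" for u k
    unfolding L_def p_def using coeff_subst[of X \<phi> u "length v" k] assms that by blast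
  have short: "coeff (p w) v = 0" if "w \<in> lists X" "length v < length w" for w
    unfolding p_def using that assms(2) by (intro coeff_prod_list_short) auto
  have "coeff (subst X \<phi> f * subst X \<phi> g) v
      = (\<Sum>j\<le>length v. (\<Sum>u\<in>L. \<Sum>w\<in>L. coeff f u * coeff (p u) (take j v) * (coeff g w * coeff (p w) (drop j v))))"
    by (simp add: coeff_mult cs sum_product)
  also have "\<dots> = (\<Sum>u\<in>L. \<Sum>w\<in>L. \<Sum>j\<le>length v.
      coeff f u * coeff (p u) (take j v) * (coeff g w * coeff (p w) (drop j v)))"
    by (subst sum.swap) (intro sum.cong refl sum.swap)
  also have "\<dots> = (\<Sum>u\<in>L. \<Sum>w\<in>L. coeff f u * coeff g w * coeff (p (u @ w)) v)"
    by (simp add: p_def coeff_mult sum_distrib_left mult_ac)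
  also have "\<dots> = (\<Sum>(u, w)\<in>L \<times> L. coeff f u * coeff g w * coeff (p (u @ w)) v)"
    by (simp add: sum.cartesian_product)
  \<comment> \<open>Pairs with \<open>u @ w\<close> longer than \<open>v\<close> contribute
    nothing.\<close>
  also have "\<dots> = (\<Sum>(u, w)\<in>{(u, w). u @ w \<in> L}. coeff f u * coeff g w * coeff (p (u @ w)) v)"
  proof (rule sum.mono_neutral_right)
    show "\<forall>i\<in>L \<times> L - {(u, w). u @ w \<in> L}.
        (case i of (u, w) \<Rightarrow> coeff f u * coeff g w * coeff (p (u @ w)) v) = 0"
    proof
      fix i assume i: "i \<in> L \<times> L - {(u, w). u @ w \<in> L}"
      obtain u w where uw: "i = (u, w)" by (cases i)
      have "coeff (p (u @ w)) v = 0" using i uw by (intro short) (auto simp: L_def)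
      then show "(case i of (u, w) \<Rightarrow> coeff f u * coeff g w * coeff (p (u @ w)) v) = 0"
        using uw by simp
    qed
  qed (use fin in \<open>auto simp: L_def\<close>)
  \<comment> \<open>The remaining pairs correspond to a word together with a cutting position, as in
    the coefficient formula for a product.\<close>
  also have "\<dots> = (\<Sum>(w, i)\<in>Sigma L (\<lambda>w. {..length w}). coeff f (take i w) * coeff g (drop i w) * coeff (p w) v)"
    by (rule sum.reindex_bij_witness[where i = "\<lambda>(w, i). (take i w, drop i w)"
          and j = "\<lambda>(u, w). (u @ w, length u)"]) auto
  also have "\<dots> = (\<Sum>w\<in>L. \<Sum>i\<le>length w. coeff f (take i w) * coeff g (drop i w) * coeff (p w) v)"
    using fin by (simp add: sum.Sigma)
  also have "\<dots> = coeff (subst X \<phi> (f * g)) v"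
    by (simp add: cs coeff_mult sum_distrib_right)
  finally show "coeff (subst X \<phi> (f * g)) v = coeff (subst X \<phi> f * subst X \<phi> g) v" ..
qed

lemma subst_commutator:
  assumes "finite X" "\<And>x. x \<in> X \<Longrightarrow> coeff (\<phi> x) [] = 0"
  shows "subst X \<phi> (commutator f g) = commutator (subst X \<phi> f) (subst X \<phi> g)"
  by (simp add: commutator_def subst_diff subst_mult[OF assms])

lemma subst_prod_list:
  assumes "finite X" "\<And>x. x \<in> X \<Longrightarrow> coeff (\<phi> x) [] = 0"
  shows "subst X \<phi> (prod_list fs) = prod_list (map (subst X \<phi>) fs)"
  by (induction fs) (simp_all add: subst_mult[OF assms] assms(1))

lemma subst_subst:
  fixes \<phi> :: "'y \<Rightarrow> ('z, 'k::comm_ring_1) ncseries" and \<psi> :: "'x \<Rightarrow> ('y, 'k) ncseries"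
  assumes "finite X" "\<And>x. x \<in> X \<Longrightarrow> coeff (\<phi> x) [] = 0"
    and "finite Y" "\<And>y. y \<in> Y \<Longrightarrow> coeff (\<psi> y) [] = 0"
  shows "subst X \<phi> (subst Y \<psi> f) = subst Y (\<lambda>y. subst X \<phi> (\<psi> y)) f"
proof (rule ncseries_eqI)
  fix v :: "'z list"
  define L where "L = {w. w \<in> lists X \<and> length w \<le> length v}"
  define M where "M = {w. w \<in> lists Y \<and> length w \<le> length v}"
  have "coeff (subst X \<phi> (subst Y \<psi> f)) v =
      (\<Sum>w\<in>L. coeff (subst Y \<psi> f) w * coeff (prod_list (map \<phi> w)) v)"
    by (simp add: subst_def L_def)
  \<comment> \<open>All inner sums are extended to the words of length at most
    \<open>length v\<close>, so that their range no longer depends on \<open>w\<close> and the two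
    sums can be exchanged.\<close>
  also have "\<dots> = (\<Sum>w\<in>L. \<Sum>u\<in>M. coeff f u * coeff (prod_list (map \<psi> u)) w * coeff (prod_list (map \<phi> w)) v)"
    by (rule sum.cong)
      (auto simp: L_def M_def sum_distrib_right coeff_subst[OF assms(3,4), where n = "length v"])
  also have "\<dots> = (\<Sum>u\<in>M. coeff f u * coeff (subst X \<phi> (prod_list (map \<psi> u))) v)"
    by (subst sum.swap) (simp add: subst_def L_def sum_distrib_left mult.assoc)
  also have "\<dots> = coeff (subst Y (\<lambda>y. subst X \<phi> (\<psi> y)) f) v"
    by (simp add: subst_prod_list[OF assms(1,2)] comp_def) (simp add: subst_def M_def)
  finally show "coeff (subst X \<phi> (subst Y \<psi> f)) v = coeff (subst Y (\<lambda>y. subst X \<phi> (\<psi> y)) f) v" .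
qed

text \<open>Allows the passage to a larger finite alphabet, needed when membership in the enveloping
  ideal involves letters absent from the given series.\<close>

lemma subst_supported:
  assumes "supported X f" "X \<subseteq> Y" "finite Y"
  shows "subst Y \<phi> f = subst X \<phi> f"
proof (rule ncseries_eqI)
  fix v
  show "coeff (subst Y \<phi> f) v = coeff (subst X \<phi> f) v"
    unfolding subst_def coeff_NCSeries
  proof (rule sum.mono_neutral_right)
    show "\<forall>w\<in>{w \<in> lists Y. length w \<le> length v} - {w \<in> lists X. length w \<le> length v}.
        coeff f w * coeff (prod_list (map \<phi> w)) v = 0"
      using assms(1) unfolding supported_def by (metis (lifting) DiffD1 DiffD2 mem_Collect_eq mult_zero_left)
  qed (use assms finite_words lists_mono[OF assms(2)] in blast)+
qed

lemma coeff_letter_mult: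
  "coeff (letter x * f) v = (case v of [] \<Rightarrow> 0 | y # u \<Rightarrow> if y = x then coeff f u else 0)"
proof (cases v)
  case (Cons y u)
  have "coeff (letter x * f) v = (\<Sum>i\<le>length v. if i = 1 then (if y = x then coeff f u else 0) else 0)"
    unfolding coeff_mult
  proof (rule sum.cong)
    fix i assume "i \<in> {..length v}"
    then show "coeff (letter x) (take i v) * coeff f (drop i v)
        = (if i = 1 then (if y = x then coeff f u else 0) else 0)"
      using Cons by (cases i) (auto simp: coeff_letter)
  qed auto
  also have "\<dots> = (if y = x then coeff f u else 0)"
    by (subst sum.delta) (auto simp: Cons)
  finally show ?thesis using Cons by simp
qed (simp add: coeff_letter)

lemma coeff_prod_list_letters: "coeff (prod_list (map letter w)) v = (if v = w then 1 else 0)"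
  by (induction w arbitrary: v) (auto simp: coeff_one coeff_letter_mult split: list.split)

lemma subst_letters_id:
  assumes "finite X" "supported X f"
  shows "subst X letter f = f"
proof (rule ncseries_eqI)
  fix v
  have "coeff (subst X letter f) v =
    (\<Sum>w | w \<in> lists X \<and> length w \<le> length v. if w = v then coeff f w else 0)"
    unfolding subst_def coeff_NCSeries by (rule sum.cong) (auto simp: coeff_prod_list_letters)
  also have "\<dots> = coeff f v"
    using assms by (subst sum.delta) (auto simp: finite_words supported_def)
  finally show "coeff (subst X letter f) v = coeff f v" .
qed

lemma coeff_prod_list_linear_forms:
  assumes "\<And>f. f \<in> set fs \<Longrightarrow> linear_form f" "coeff (prod_list fs) v \<noteq> 0"
  shows "length v = length fs"
  using assms
proof (induction fs arbitrary: v)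
  case (Cons f fs)
  then obtain i where i: "i \<le> length v" "coeff f (take i v) * coeff (prod_list fs) (drop i v) \<noteq> 0"
    by (auto simp: coeff_mult elim: sum.not_neutral_contains_not_neutral)
  then have "coeff f (take i v) \<noteq> 0" "coeff (prod_list fs) (drop i v) \<noteq> 0" by auto
  moreover have "linear_form f" using Cons.prems by simp
  ultimately have "length (take i v) = 1" "length (drop i v) = length fs"
    using Cons.IH[of "drop i v"] Cons.prems(1) unfolding linear_form_def by force+
  then show ?case by auto
qed (auto simp: coeff_one split: if_splits)

text \<open>Substituting linear forms turns a word of length m into a series homogeneous of degree
  m, so the substitution respects the grading.\<close>

lemma hom_part_subst:
  assumes "\<And>x. x \<in> X \<Longrightarrow> linear_form (\<phi> x)"
  shows "hom_part d (subst X \<phi> f) = subst X \<phi> (hom_part d f)"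
proof (rule ncseries_eqI)
  fix v
  have "length v = length w" if "w \<in> lists X" "coeff (prod_list (map \<phi> w)) v \<noteq> 0" for w
    using coeff_prod_list_linear_forms[of "map \<phi> w" v] that assms by auto
  then have eq: "coeff (hom_part d f) w * coeff (prod_list (map \<phi> w)) v
      = (if length v = d then coeff f w * coeff (prod_list (map \<phi> w)) v else 0)" if "w \<in> lists X" for w
    using that by (cases "coeff (prod_list (map \<phi> w)) v = 0") (auto simp: coeff_hom_part)
  have "coeff (subst X \<phi> (hom_part d f)) v = (\<Sum>w | w \<in> lists X \<and> length w \<le> length v.
      if length v = d then coeff f w * coeff (prod_list (map \<phi> w)) v else 0)"
    unfolding subst_def coeff_NCSeries using eq by (intro sum.cong) auto
  then show "coeff (hom_part d (subst X \<phi> f)) v = coeff (subst X \<phi> (hom_part d f)) v"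
    by (simp add: coeff_hom_part subst_def)
qed


section \<open>Group-like series at multiples of a letter\<close>

text \<open>The weights commute, so the letters at positions in \<open>S\<close> and outside it can
  be regrouped. Complementarity is required only below \<open>length w\<close>, a form that survives
  the shift of positions in the induction.\<close>

lemma nths_prod_list_complement:
  fixes c :: "'x \<Rightarrow> 'k::comm_monoid_mult"
  assumes "\<And>i. i < length w \<Longrightarrow> i \<in> S \<longleftrightarrow> i \<notin> S'"
  shows "prod_list (map c (nths w S)) * prod_list (map c (nths w S')) = prod_list (map c w)"
  using assms
proof (induction w arbitrary: S S')
  case (Cons x w)
  have "prod_list (map c (nths w {j. Suc j \<in> S})) * prod_list (map c (nths w {j. Suc j \<in> S'}))
      = prod_list (map c w)"
    using Cons.prems by (intro Cons.IH) auto
  moreover have "0 \<in> S \<longleftrightarrow> 0 \<notin> S'" using Cons.prems by auto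
  ultimately show ?case by (auto simp: nths_Cons mult_ac)
qed simp

section \<open>Exponentials of multiples of one letter\<close>

lemma coeff_scale_letter_power:
  "coeff (scale c (letter y) ^ n) v = (if v = replicate n y then c ^ n else 0)"
proof (induction n arbitrary: v)
  case (Suc n)
  then show ?case
    by (auto simp: scale_mult_left coeff_letter_mult split: list.split)
qed (simp add: coeff_one)

lemma eq_replicate_length_iff: "v = replicate (length v) y \<longleftrightarrow> set v \<subseteq> {y}"
proof
  assume "set v \<subseteq> {y}"
  then show "v = replicate (length v) y" by (intro replicate_length_same[symmetric]) auto
next
  assume "v = replicate (length v) y"
  then have "set v = set (replicate (length v) y)" by (rule arg_cong)
  then show "set v \<subseteq> {y}" by (simp add: set_replicate_conv_if split: if_splits)
qed

lemma coeff_ncexp_scale_letter: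
  "coeff (ncexp (scale c (letter y))) v =
    (if set v \<subseteq> {y} then c ^ length v / fact (length v) else 0)"
proof -
  have iff: "v = replicate n y \<longleftrightarrow> n = length v \<and> set v \<subseteq> {y}" for n
    using eq_replicate_length_iff[of v y] by (metis length_replicate)
  have "coeff (ncexp (scale c (letter y))) v = (\<Sum>n\<le>length v. if n = length v then
      (if set v \<subseteq> {y} then c ^ length v / fact (length v) else 0) else 0)"
    unfolding ncexp_def coeff_NCSeries coeff_scale_letter_power iff by (rule sum.cong) auto
  then show ?thesis by simp
qed

lemma ncexp_0 [simp]: "ncexp (0 :: ('x, 'k::field_char_0) ncseries) = 1"
proof (rule ncseries_eqI)
  fix v :: "'x list"
  \<comment> \<open>Zero is the multiple by 0 of any letter, \<open>undefined\<close> being one;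
    \<open>0 ^ 0 = 1\<close> supplies the constant term.\<close>
  have "coeff (ncexp (0 :: ('x, 'k) ncseries)) v = coeff (ncexp (scale (0::'k) (letter undefined))) v"
    by simp
  also have "\<dots> = coeff 1 v"
    unfolding coeff_ncexp_scale_letter by (auto simp: coeff_one)
  finally show "coeff (ncexp (0 :: ('x, 'k) ncseries)) v = coeff 1 v" .
qed

text \<open>The coefficient at a power of \<open>y\<close> of length n is the binomial expansion of
  \<open>(a + b) ^ n\<close>, divided by \<open>fact n\<close>.\<close>

lemma ncexp_scale_letter_mult:
  fixes a b :: "'k::field_char_0" and y :: 'x
  shows "ncexp (scale a (letter y)) * ncexp (scale b (letter y)) = ncexp (scale (a + b) (letter y))"
proof (rule ncseries_eqI)
  fix v :: "'x list"
  let ?n = "length v"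
  have split: "set (take i v) \<subseteq> {y} \<and> set (drop i v) \<subseteq> {y} \<longleftrightarrow> set v \<subseteq> {y}" for i
    by (metis append_take_drop_id set_append Un_subset_iff)
  have "coeff (ncexp (scale a (letter y)) * ncexp (scale b (letter y))) v
      = (\<Sum>i\<le>?n. if set v \<subseteq> {y} then a ^ i / fact i * (b ^ (?n - i) / fact (?n - i)) else 0)"
  proof -
    have "(if P then x else 0) * (if Q then z else 0) = (if R then x * z else 0)"
      if "P \<and> Q \<longleftrightarrow> R" for P Q R and x z :: 'k
      using that by auto
    from this[OF split] show ?thesis
      unfolding coeff_mult coeff_ncexp_scale_letter by (intro sum.cong) (simp_all add: min_absorb2)
  qed
  also have "\<dots> = (if set v \<subseteq> {y} then (a + b) ^ ?n / fact ?n else 0)"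
    by (auto simp: binomial_ring sum_divide_distrib binomial_fact field_simps intro!: sum.cong)
  finally show "coeff (ncexp (scale a (letter y)) * ncexp (scale b (letter y))) v
      = coeff (ncexp (scale (a + b) (letter y))) v"
    by (simp only: coeff_ncexp_scale_letter)
qed

section \<open>The exponential recursion for group-like series\<close>

lemma length_nths_subset:
  assumes "S \<subseteq> {..<length w}"
  shows "length (nths w S) = card S"
  using assms by (auto simp: length_nths intro!: arg_cong[where f = card])

text \<open>
  The factor \<open>n + 1\<close>: in the coproduct formula for \<open>coeff h [x] * coeff h u\<close>, a word of length
  \<open>n + 1\<close> splits in \<open>n + 1\<close> ways as a letter and a word of length \<open>n\<close>.
\<close>

lemma group_like_weighted_sum_Suc:
  fixes h :: "('x, 'k::field_char_0) ncseries" and c :: "'x \<Rightarrow> 'k"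
  assumes "h \<in> exp_free_lie X" "finite X"
  defines "W n \<equiv> {w. w \<in> lists X \<and> length w = n}"
  defines "e n \<equiv> \<Sum>w\<in>W n. prod_list (map c w) * coeff h w"
  shows "of_nat (Suc n) * e (Suc n) = e 1 * e n"
proof -
  let ?c = "\<lambda>w. prod_list (map c w)"
  let ?Q = "\<lambda>w x u S. nths w S = x \<and> nths w ({..<length w} - S) = u"
  have fin: "finite (W n)" for n unfolding W_def by (rule finite_words_eq) fact
  \<comment> \<open>The weight \<open>?c\<close> is multiplicative: for fixed \<open>w\<close>, a
    set \<open>S\<close> of positions determines the pair \<open>(x, u)\<close> and contributes
    \<open>?c w\<close> exactly when \<open>S\<close> is a singleton. The sum thus counts
    singletons.\<close>
  have inner: "(\<Sum>x\<in>W 1. \<Sum>u\<in>W n. ?c x * ?c u * of_nat (card {S. S \<subseteq> {..<length w} \<and> ?Q w x u S}))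
      = of_nat (Suc n) * ?c w" (is "?lhs = _") if w: "w \<in> W (Suc n)" for w
  proof -
    let ?P = "Pow {..<length w}"
    have card: "of_nat (card {S. S \<subseteq> {..<length w} \<and> ?Q w x u S})
        = (\<Sum>S\<in>?P. if ?Q w x u S then 1 else (0::'k))" for x u
      by (simp add: sum.If_cases Pow_def Collect_conj_eq[symmetric] Int_def)
    have "?lhs = (\<Sum>x\<in>W 1. \<Sum>S\<in>?P. \<Sum>u\<in>W n. ?c x * ?c u * (if ?Q w x u S then 1 else 0))"
      unfolding card sum_distrib_left by (intro sum.cong refl sum.swap)
    also have "\<dots> = (\<Sum>S\<in>?P. \<Sum>x\<in>W 1. \<Sum>u\<in>W n. ?c x * ?c u * (if ?Q w x u S then 1 else 0))"
      by (rule sum.swap)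
    also have "\<dots> = (\<Sum>S\<in>?P. if card S = 1 then ?c w else 0)"
    proof (rule sum.cong)
      fix S assume S: "S \<in> ?P"
      define x' u' where "x' = nths w S" and "u' = nths w ({..<length w} - S)"
      have len: "length x' = card S" "length u' = length w - card S"
        using S by (auto simp: x'_def u'_def length_nths_subset card_Diff_subset finite_subset)
      have le: "card S \<le> length w" using S card_mono[of "{..<length w}" S] by simp
      have lists: "x' \<in> lists X" "u' \<in> lists X"
        using w set_nths_subset[of w] by (auto simp: x'_def u'_def W_def)
      have prod: "?c x' * ?c u' = ?c w"
        unfolding x'_def u'_def by (rule nths_prod_list_complement) auto
      have "(\<Sum>x\<in>W 1. \<Sum>u\<in>W n. ?c x * ?c u * (if ?Q w x u S then 1 else 0))
          = (\<Sum>x\<in>W 1. \<Sum>u\<in>W n. if u = u' then if x = x' then ?c w else 0 else 0)"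
        by (intro sum.cong refl) (auto simp: prod[symmetric] x'_def u'_def)
      also have "\<dots> = (\<Sum>x\<in>W 1. if x = x' then if u' \<in> W n then ?c w else 0 else 0)"
        by (intro sum.cong refl) (simp add: sum.delta fin)
      also have "\<dots> = (if x' \<in> W 1 \<and> u' \<in> W n then ?c w else 0)"
        by (simp add: sum.delta fin)
      also have "x' \<in> W 1 \<and> u' \<in> W n \<longleftrightarrow> card S = 1"
        using w len le lists by (auto simp: W_def)
      finally show "(\<Sum>x\<in>W 1. \<Sum>u\<in>W n. ?c x * ?c u * (if ?Q w x u S then 1 else 0))
          = (if card S = 1 then ?c w else 0)" .
    qed simp
    also have "\<dots> = of_nat (card {S. S \<subseteq> {..<length w} \<and> card S = 1}) * ?c w"
      by (simp add: sum.If_cases Pow_def Collect_conj_eq[symmetric] Int_def)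
    also have "\<dots> = of_nat (Suc n) * ?c w"
      using w n_subsets[of "{..<length w}" 1] by (simp add: W_def)
    finally show ?thesis .
  qed
  have "e 1 * e n = (\<Sum>x\<in>W 1. \<Sum>u\<in>W n. ?c x * ?c u * (coeff h x * coeff h u))"
    unfolding e_def sum_product by (intro sum.cong refl) (simp add: mult_ac)
  also have "\<dots> = (\<Sum>x\<in>W 1. \<Sum>u\<in>W n. ?c x * ?c u * coproduct X h x u)"
    using assms(1) by (simp add: exp_free_lie_def)
  also have "\<dots> = (\<Sum>x\<in>W 1. \<Sum>u\<in>W n. \<Sum>w\<in>W (Suc n).
      coeff h w * (?c x * ?c u * of_nat (card {S. S \<subseteq> {..<length w} \<and> ?Q w x u S})))"
  proof (intro sum.cong refl)
    fix x u assume "x \<in> W 1" "u \<in> W n"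
    then have "{w. w \<in> lists X \<and> length w = length x + length u} = W (Suc n)"
      by (auto simp: W_def)
    then show "?c x * ?c u * coproduct X h x u = (\<Sum>w\<in>W (Suc n).
      coeff h w * (?c x * ?c u * of_nat (card {S. S \<subseteq> {..<length w} \<and> ?Q w x u S})))"
      by (simp add: coproduct_def sum_distrib_left mult_ac)
  qed
  also have "\<dots> = (\<Sum>x\<in>W 1. \<Sum>w\<in>W (Suc n). \<Sum>u\<in>W n.
      coeff h w * (?c x * ?c u * of_nat (card {S. S \<subseteq> {..<length w} \<and> ?Q w x u S})))"
    by (intro sum.cong refl sum.swap)
  also have "\<dots> = (\<Sum>w\<in>W (Suc n). coeff h w * (\<Sum>x\<in>W 1. \<Sum>u\<in>W n.
      ?c x * ?c u * of_nat (card {S. S \<subseteq> {..<length w} \<and> ?Q w x u S})))"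
    by (subst sum.swap) (simp add: sum_distrib_left)
  also have "\<dots> = of_nat (Suc n) * e (Suc n)"
    unfolding e_def sum_distrib_left[of "of_nat (Suc n)"]
    by (intro sum.cong refl) (simp only: inner mult.commute[of "prod_list _" "coeff h _"] mult.left_commute[of "coeff h _" "of_nat (Suc n)"])
  finally show ?thesis ..
qed

text \<open>The coefficient at the n-th power of \<open>y\<close> is the weighted sum
  \<open>e n\<close> of the preceding recursion, which forces \<open>e n = e 1 ^ n / fact n\<close>.
  Conceptually, group-like series in one variable are exponentials of multiples of that
  variable.\<close>

lemma subst_group_like_scaled_letter:
  fixes h :: "('x, 'k::field_char_0) ncseries"
  assumes "h \<in> exp_free_lie X" "finite X"
  shows "subst X (\<lambda>x. scale (c x) (letter y)) h
    = ncexp (scale (\<Sum>x\<in>X. c x * coeff h [x]) (letter y))"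
proof (rule ncseries_eqI)
  fix v
  define e where "e n = (\<Sum>w | w \<in> lists X \<and> length w = n. prod_list (map c w) * coeff h w)" for n
  have e0: "e 0 = 1"
  proof -
    have "{w. w \<in> lists X \<and> length w = 0} = {[]}" by auto
    then show ?thesis using assms(1) by (simp add: e_def exp_free_lie_def)
  qed
  have e1: "e 1 = (\<Sum>x\<in>X. c x * coeff h [x])"
  proof -
    have "{w. w \<in> lists X \<and> length w = 1} = (\<lambda>x. [x]) ` X" by (auto simp: length_Suc_conv)
    then show ?thesis by (simp add: e_def sum.reindex inj_on_def)
  qed
  have e: "e n = e 1 ^ n / fact n" for n
  proof (induction n)
    case (Suc n)
    have "of_nat (Suc n) * e (Suc n) = e 1 * (e 1 ^ n / fact n)"
      using group_like_weighted_sum_Suc[OF assms, where c = c] Suc by (simp add: e_def)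
    then show ?case by (simp add: field_simps del: of_nat_Suc)
  qed (simp add: e0)
  have p: "prod_list (map (\<lambda>x. scale (c x) (letter y)) w)
      = scale (prod_list (map c w)) (letter y ^ length w)" for w
    by (induction w) (simp_all add: scale_mult_left scale_mult_right scale_scale mult.commute)
  have "coeff (letter y ^ n) v = (if v = replicate n y then 1 else 0 :: 'k)" for n
    using coeff_scale_letter_power[of 1 y n v] by (simp only: scale_1 power_one)
  then have pow: "coeff (letter y ^ n) v = (if n = length v \<and> set v \<subseteq> {y} then 1 else 0 :: 'k)" for n
    using eq_replicate_length_iff[of v y] by (metis length_replicate)
  have "coeff (subst X (\<lambda>x. scale (c x) (letter y)) h) v
      = (\<Sum>w | w \<in> lists X \<and> length w \<le> length v.
          if length w = length v \<and> set v \<subseteq> {y} then prod_list (map c w) * coeff h w else 0)"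
    unfolding subst_def coeff_NCSeries p by (rule sum.cong) (simp_all add: pow mult.commute)
  also have "\<dots> = (\<Sum>w | w \<in> lists X \<and> length w = length v.
      if set v \<subseteq> {y} then prod_list (map c w) * coeff h w else 0)"
    by (rule sum.mono_neutral_cong_right) (use finite_words[OF assms(2)] in auto)
  also have "\<dots> = (if set v \<subseteq> {y} then e (length v) else 0)"
    by (simp add: e_def)
  finally show "coeff (subst X (\<lambda>x. scale (c x) (letter y)) h) v
      = coeff (ncexp (scale (\<Sum>x\<in>X. c x * coeff h [x]) (letter y))) v"
    unfolding coeff_ncexp_scale_letter e1[symmetric] e[symmetric] .
qed

section \<open>Morphisms out of the enveloping algebra\<close>

lemma finite_residues_mod [simp]: "finite (residues_mod N)"
  by (simp add: residues_mod_def)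

lemma finite_gens [simp]: "finite (gens n N)"
proof -
  have "gens n N \<subseteq> T1 ` {2..n} \<union> (\<lambda>(a, i, j). T a i j) ` (residues_mod N \<times> {2..n} \<times> {2..n})"
    by (auto simp: gens_def image_iff)
  then show ?thesis by (rule finite_subset) simp
qed

lemma finite_gens3 [simp]: "finite (gens3 N)"
  by (simp add: gens3_def)

lemma sum_gens3: "(\<Sum>x\<in>gens3 N. f x) = f A + (\<Sum>a\<in>residues_mod N. f (B a))"
  unfolding gens3_def by (subst sum.union_disjoint) (auto simp: sum.reindex inj_on_def)

lemma commutator_0 [simp]: "commutator 0 x = 0" "commutator x 0 = 0"
  by (simp_all add: commutator_def)

section \<open>Compatibility of substitutions with Lie and enveloping ideals\<close>

lemma subst_lie_ideal:
  assumes "finite X" "\<And>x. x \<in> X \<Longrightarrow> coeff (\<phi> x) [] = 0"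
    and "\<And>r. r \<in> R \<Longrightarrow> subst X \<phi> r = 0"
    and "j \<in> lie_ideal (free_lie X) R"
  shows "subst X \<phi> j = 0"
  using assms(4)
  by induction (simp_all add: assms(3) free_lie_def lie_subalgebra_def ncseries_lie_def
      subst_add subst_scale subst_commutator[OF assms(1,2)])

text \<open>Elements of the quotient are cosets. The map that \<open>F\<close> induces on them takes
  the common value of \<open>F\<close> on a coset, and is meaningful only where that value is
  unique.\<close>

definition class_value :: "('p \<Rightarrow> 'q) \<Rightarrow> 'p set \<Rightarrow> 'q" where
  "class_value F P = the_elem (F ` P)"

lemma class_valueI: "F ` P = {s} \<Longrightarrow> class_value F P = s"
  by (simp add: class_value_def)

text \<open>
  The alphabet \<open>lcarrier L\<close> is infinite, whereas \<^const>\<open>subst\<close> is meaningful over finite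
  alphabets only, so the substitution is taken over any large enough finite alphabet.
\<close>

lemma subst_uea_ideal:
  fixes \<phi> :: "'g \<Rightarrow> ('y, 'k::comm_ring_1) ncseries"
  assumes const: "\<And>x. x \<in> lcarrier L \<Longrightarrow> coeff (\<phi> x) [] = 0"
    and hom_add: "\<And>x y. x \<in> lcarrier L \<Longrightarrow> y \<in> lcarrier L \<Longrightarrow> \<phi> (ladd L x y) = \<phi> x + \<phi> y"
    and hom_scale: "\<And>c x. x \<in> lcarrier L \<Longrightarrow> \<phi> (lscale L c x) = scale c (\<phi> x)"
    and hom_bracket: "\<And>x y. x \<in> lcarrier L \<Longrightarrow> y \<in> lcarrier L \<Longrightarrow>
      \<phi> (lbracket L x y) = commutator (\<phi> x) (\<phi> y)"
    and "f \<in> uea_ideal L"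
  shows "\<exists>X0. finite X0 \<and> (\<forall>x\<in>X0. coeff (\<phi> x) [] = 0) \<and>
    (\<forall>X. finite X \<longrightarrow> X0 \<subseteq> X \<longrightarrow> (\<forall>x\<in>X. coeff (\<phi> x) [] = 0) \<longrightarrow> subst X \<phi> f = 0)"
proof -
  let ?K = "\<lambda>X0 f. finite X0 \<and> (\<forall>x\<in>X0. coeff (\<phi> x) [] = 0) \<and>
    (\<forall>X. finite X \<longrightarrow> X0 \<subseteq> X \<longrightarrow> (\<forall>x\<in>X. coeff (\<phi> x) [] = 0) \<longrightarrow> subst X \<phi> f = 0)"
  show ?thesis
    using assms(5)
  proof induction
    case (rel_add x y)
    \<comment> \<open>The letters of the relation must lie in the alphabet, as \<open>subst\<close>
      sends letters outside it to 0.\<close>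
    show ?case
    proof (intro exI[of _ "{x, y, ladd L x y}"] conjI allI impI)
      fix X assume X: "finite X" "{x, y, ladd L x y} \<subseteq> X" "\<forall>x\<in>X. coeff (\<phi> x) [] = 0"
      have "subst X \<phi> (letter z) = \<phi> z" if "z \<in> {x, y, ladd L x y}" for z
        using X that by (intro subst_letter) auto
      then show "subst X \<phi> (letter (ladd L x y) - letter x - letter y) = 0"
        using X rel_add by (simp add: subst_diff hom_add)
    qed (use rel_add in \<open>auto simp: const hom_add\<close>)
  next
    case (rel_scale x c)
    show ?case
    proof (intro exI[of _ "{x, lscale L c x}"] conjI allI impI)
      fix X assume X: "finite X" "{x, lscale L c x} \<subseteq> X" "\<forall>x\<in>X. coeff (\<phi> x) [] = 0"
      have "subst X \<phi> (letter z) = \<phi> z" if "z \<in> {x, lscale L c x}" for z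
        using X that by (intro subst_letter) auto
      then show "subst X \<phi> (letter (lscale L c x) - scale c (letter x)) = 0"
        using X rel_scale by (simp add: subst_diff subst_scale hom_scale)
    qed (use rel_scale in \<open>auto simp: const hom_scale\<close>)
  next
    case (rel_bracket x y)
    show ?case
    proof (intro exI[of _ "{x, y, lbracket L x y}"] conjI allI impI)
      fix X assume X: "finite X" "{x, y, lbracket L x y} \<subseteq> X" "\<forall>x\<in>X. coeff (\<phi> x) [] = 0"
      have "subst X \<phi> (letter z) = \<phi> z" if "z \<in> {x, y, lbracket L x y}" for z
        using X that by (intro subst_letter) auto
      then show "subst X \<phi> (commutator (letter x) (letter y) - letter (lbracket L x y)) = 0"
        using X rel_bracket by (simp add: subst_diff subst_commutator hom_bracket)
    qed (use rel_bracket in \<open>auto simp: const hom_bracket commutator_def\<close>)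
  next
    case zero
    then show ?case by (intro exI[of _ "{}"]) simp
  next
    case (add p q)
    then obtain Xp Xq where "?K Xp p" "?K Xq q" by blast
    then show ?case by (intro exI[of _ "Xp \<union> Xq"]) (auto simp: subst_add)
  next
    case (scale p c)
    then obtain Xp where "?K Xp p" by blast
    then show ?case by (intro exI[of _ Xp]) (simp add: subst_scale)
  next
    \<comment> \<open>No letter is added for \<open>x\<close>: the factor \<open>p\<close> already
      goes to 0, whatever the image of \<open>letter x\<close>.\<close>
    case (mult_left x p)
    then obtain Xp where "?K Xp p" by blast
    then show ?case by (intro exI[of _ Xp]) (simp add: subst_mult)
  next
    case (mult_right x p)
    then obtain Xp where "?K Xp p" by blast
    then show ?case by (intro exI[of _ Xp]) (simp add: subst_mult)
  qed
qed

text \<open>Equality in the completion is tested in each degree, and a graded substitution commutes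
  with \<open>hom_part\<close>.\<close>

lemma subst_cuea_eq:
  fixes \<phi> :: "'g \<Rightarrow> ('y, 'k::comm_ring_1) ncseries"
  assumes const: "\<And>x. x \<in> lcarrier L \<Longrightarrow> coeff (\<phi> x) [] = 0"
    and hom_add: "\<And>x y. x \<in> lcarrier L \<Longrightarrow> y \<in> lcarrier L \<Longrightarrow> \<phi> (ladd L x y) = \<phi> x + \<phi> y"
    and hom_scale: "\<And>c x. x \<in> lcarrier L \<Longrightarrow> \<phi> (lscale L c x) = scale c (\<phi> x)"
    and hom_bracket: "\<And>x y. x \<in> lcarrier L \<Longrightarrow> y \<in> lcarrier L \<Longrightarrow>
      \<phi> (lbracket L x y) = commutator (\<phi> x) (\<phi> y)"
    and eq: "cuea_eq L P Q"
    and X: "finite X" "\<And>x. x \<in> X \<Longrightarrow> linear_form (\<phi> x)" "supported X P" "supported X Q"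
  shows "subst X \<phi> P = subst X \<phi> Q"
proof -
  have "hom_part d (subst X \<phi> P) = hom_part d (subst X \<phi> Q)" for d
  proof -
    have "hom_part d P - hom_part d Q \<in> uea_ideal L" using eq by (simp add: cuea_eq_def)
    from subst_uea_ideal[where \<phi> = \<phi>, OF const hom_add hom_scale hom_bracket this]
    obtain X0 where X0: "finite X0" "\<forall>x\<in>X0. coeff (\<phi> x) [] = 0"
      "\<And>Y. finite Y \<Longrightarrow> X0 \<subseteq> Y \<Longrightarrow> (\<forall>x\<in>Y. coeff (\<phi> x) [] = 0) \<Longrightarrow>
        subst Y \<phi> (hom_part d P - hom_part d Q) = 0"
      by blast
    \<comment> \<open>The ideal supplies its own alphabet \<open>X0\<close>; adjoining it does not
      alter substitutions into series supported in \<open>X\<close>.\<close>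
    have "subst (X0 \<union> X) \<phi> (hom_part d P - hom_part d Q) = 0"
      using X0 X by (intro X0(3)) (auto intro: linear_form_const)
    moreover have "subst (X0 \<union> X) \<phi> (hom_part d S) = subst X \<phi> (hom_part d S)"
      if "supported X S" for S
      using that X X0 by (intro subst_supported supported_hom_part) auto
    ultimately show ?thesis
      using X by (simp add: subst_diff hom_part_subst)
  qed
  then show ?thesis
    by (metis coeff_hom_part ncseries_eqI)
qed

section \<open>The map on cosets induced by an assignment of the generators\<close>

context
  fixes n N :: nat and \<sigma> :: "gen \<Rightarrow> ('y, 'k::field_char_0) ncseries"
  assumes const: "\<And>x. x \<in> gens n N \<Longrightarrow> coeff (\<sigma> x) [] = 0"
    and rel: "\<And>r. r \<in> relators n N \<Longrightarrow> subst (gens n N) \<sigma> r = 0"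
begin

abbreviation (input) "gens_subst \<equiv> subst (gens n N) \<sigma>"

text \<open>The ideal of relations goes to 0, so the substitution is constant on each coset.\<close>

lemma image_lcoset:
  "gens_subst ` lcoset (free_lie (gens n N)) (lie_ideal (free_lie (gens n N)) (relators n N)) x = {gens_subst x}"
proof -
  have "gens_subst (x + j) = gens_subst x" if "j \<in> lie_ideal (free_lie (gens n N)) (relators n N)" for j
    using subst_lie_ideal[OF finite_gens const rel that] by (simp add: subst_add)
  moreover have "0 \<in> lie_ideal (free_lie (gens n N)) (relators n N)"
    using lie_ideal.zero[of "free_lie (gens n N)"]
    by (simp add: free_lie_def lie_subalgebra_def ncseries_lie_def)
  ultimately show ?thesis
    by (auto simp: lcoset_def free_lie_def lie_subalgebra_def ncseries_lie_def image_iff)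
qed

lemma class_value_cls: "class_value gens_subst (cls n N x) = gens_subst x"
  by (simp add: cls_def class_valueI image_lcoset)

text \<open>A singleton image records that a coset is nonempty and that the substitution is constant
  on it. Both matter, since the quotient operations are unions over all representatives.\<close>

lemma image_ladd:
  assumes "gens_subst ` P = {s}" "gens_subst ` Q = {s'}"
  shows "gens_subst ` ladd (lie_t0 n N) P Q = {s + s'}"
proof -
  have "\<And>x. x \<in> P \<Longrightarrow> gens_subst x = s" "\<And>x. x \<in> Q \<Longrightarrow> gens_subst x = s'" "P \<noteq> {}" "Q \<noteq> {}"
    using assms by auto
  then show ?thesis
    by (simp add: lie_t0_def lie_t_def presented_lie_def lie_quotient_def lie_subalgebra_def image_UN
        image_lcoset)
      (simp add: free_lie_def lie_subalgebra_def ncseries_lie_def subst_add)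
qed

lemma image_lbracket:
  assumes "gens_subst ` P = {s}" "gens_subst ` Q = {s'}"
  shows "gens_subst ` lbracket (lie_t0 n N) P Q = {commutator s s'}"
proof -
  have "\<And>x. x \<in> P \<Longrightarrow> gens_subst x = s" "\<And>x. x \<in> Q \<Longrightarrow> gens_subst x = s'" "P \<noteq> {}" "Q \<noteq> {}"
    using assms by auto
  then show ?thesis
    by (simp add: lie_t0_def lie_t_def presented_lie_def lie_quotient_def lie_subalgebra_def image_UN
        image_lcoset)
      (simp add: free_lie_def lie_subalgebra_def ncseries_lie_def subst_commutator const)
qed

lemma image_lscale:
  assumes "gens_subst ` P = {s}"
  shows "gens_subst ` lscale (lie_t0 n N) c P = {scale c s}"
proof -
  have "\<And>x. x \<in> P \<Longrightarrow> gens_subst x = s" "P \<noteq> {}"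
    using assms by auto
  then show ?thesis
    by (simp add: lie_t0_def lie_t_def presented_lie_def lie_quotient_def lie_subalgebra_def image_UN
        image_lcoset)
      (simp add: free_lie_def lie_subalgebra_def ncseries_lie_def subst_scale)
qed

lemma image_lie_t0_carrier:
  assumes "P \<in> lcarrier (lie_t0 n N)"
  obtains s where "gens_subst ` P = {s}" "coeff s [] = 0"
proof -
  let ?L = "lie_t n N :: ('k, (gen, 'k) ncseries set) lie_alg"
  \<comment> \<open>\<open>lie_t0\<close> differs from \<open>lie_t\<close> in its carrier only; the
    induction on generated elements is phrased with the operations of \<open>lie_t\<close>.\<close>
  have ops: "ladd ?L = ladd (lie_t0 n N)" "lscale ?L = lscale (lie_t0 n N)"
      "lbracket ?L = lbracket (lie_t0 n N)"
    by (simp_all add: lie_t0_def lie_subalgebra_def)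
  have "P \<in> lie_generated (lie_t n N) ((\<lambda>x. cls n N (letter x)) ` (gens n N - {T1 n}))"
    using assms by (simp add: lie_t0_def lie_subalgebra_def)
  then have "\<exists>s. gens_subst ` P = {s} \<and> coeff s [] = 0"
  proof induction
    case (gen x)
    then obtain y where "x = cls n N (letter y)" "y \<in> gens n N" by auto
    then show ?case by (simp add: cls_def image_lcoset coeff_letter)
  next
    case zero
    have "lzero ?L = lcoset (free_lie (gens n N))
        (lie_ideal (free_lie (gens n N)) (relators n N)) (lzero (free_lie (gens n N)))"
      by (simp add: lie_t_def presented_lie_def lie_quotient_def)
    then have "gens_subst ` lzero ?L = {gens_subst 0}"
      by (simp only: image_lcoset) (simp add: free_lie_def lie_subalgebra_def ncseries_lie_def)
    then show ?case by simp
  next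
    case (add x y)
    then obtain s s' where "gens_subst ` x = {s}" "coeff s [] = 0" "gens_subst ` y = {s'}" "coeff s' [] = 0" by blast
    then show ?case unfolding ops using image_ladd by auto
  next
    case (scale x c)
    then obtain s where "gens_subst ` x = {s}" "coeff s [] = 0" by blast
    then show ?case unfolding ops using image_lscale by auto
  next
    case (bracket x y)
    then obtain s s' where "gens_subst ` x = {s}" "coeff s [] = 0" "gens_subst ` y = {s'}" "coeff s' [] = 0" by blast
    then show ?case unfolding ops using image_lbracket by (auto simp: commutator_def)
  qed
  then show ?thesis using that by blast
qed

text \<open>On the carrier every image is a singleton without constant term, so the induced map is a
  Lie morphism there and the transfer of completed equalities applies.\<close>

lemma subst_class_value_eq:
  assumes "cuea_eq (lie_t0 n N) P Q"
    and "finite X" "\<And>x. x \<in> X \<Longrightarrow> linear_form (class_value gens_subst x)" "supported X P" "supported X Q"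
  shows "subst X (class_value gens_subst) P = subst X (class_value gens_subst) Q"
proof (rule subst_cuea_eq[OF _ _ _ _ assms])
  fix x y :: "(gen, 'k) ncseries set" and c assume "x \<in> lcarrier (lie_t0 n N)"
  then obtain s where s: "gens_subst ` x = {s}" "coeff s [] = 0" by (rule image_lie_t0_carrier)
  then show "coeff (class_value gens_subst x) [] = 0" by (simp only: class_valueI)
  show "class_value gens_subst (lscale (lie_t0 n N) c x) = scale c (class_value gens_subst x)"
    using image_lscale[OF s(1)] s(1) by (simp only: class_valueI)
  assume "y \<in> lcarrier (lie_t0 n N)"
  then obtain s' where s': "gens_subst ` y = {s'}" by (rule image_lie_t0_carrier)
  show "class_value gens_subst (ladd (lie_t0 n N) x y) = class_value gens_subst x + class_value gens_subst y"
    using image_ladd[OF s(1) s'] s(1) s' by (simp only: class_valueI)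
  show "class_value gens_subst (lbracket (lie_t0 n N) x y) = commutator (class_value gens_subst x) (class_value gens_subst y)"
    using image_lbracket[OF s(1) s'] s(1) s' by (simp only: class_valueI)
qed

end


text \<open>Reduces the vanishing on relators to six identities between images of generators, a form
  suited to concrete assignments.\<close>

lemma subst_relator:
  fixes \<sigma> :: "gen \<Rightarrow> ('y, 'k::field_char_0) ncseries"
  assumes const: "\<And>x. x \<in> gens n N \<Longrightarrow> coeff (\<sigma> x) [] = 0"
    and R1: "\<And>a i j. a \<in> residues_mod N \<Longrightarrow> {i, j} \<subseteq> {2..n} \<Longrightarrow> distinct [i, j] \<Longrightarrow>
      \<sigma> (T a i j) = \<sigma> (T ((- a) mod int N) j i)"
    and R2: "\<And>a b i j k. a \<in> residues_mod N \<Longrightarrow> b \<in> residues_mod N \<Longrightarrow> {i, j, k} \<subseteq> {2..n} \<Longrightarrow>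
      distinct [i, j, k] \<Longrightarrow>
      commutator (\<sigma> (T a i j)) (\<sigma> (T ((a + b) mod int N) i k) + \<sigma> (T b j k)) = 0"
    and R3: "\<And>a i j. a \<in> residues_mod N \<Longrightarrow> {i, j} \<subseteq> {2..n} \<Longrightarrow> distinct [i, j] \<Longrightarrow>
      commutator (\<sigma> (T1 i) + \<sigma> (T1 j) + (\<Sum>c\<in>residues_mod N. \<sigma> (T c i j))) (\<sigma> (T a i j)) = 0"
    and R4: "\<And>i j. {i, j} \<subseteq> {2..n} \<Longrightarrow> distinct [i, j] \<Longrightarrow>
      commutator (\<sigma> (T1 i)) (\<sigma> (T1 j) + (\<Sum>c\<in>residues_mod N. \<sigma> (T c i j))) = 0"
    and R5: "\<And>a i j k. a \<in> residues_mod N \<Longrightarrow> {i, j, k} \<subseteq> {2..n} \<Longrightarrow> distinct [i, j, k] \<Longrightarrow>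
      commutator (\<sigma> (T1 i)) (\<sigma> (T a j k)) = 0"
    and R6: "\<And>a b i j k l. a \<in> residues_mod N \<Longrightarrow> b \<in> residues_mod N \<Longrightarrow> {i, j, k, l} \<subseteq> {2..n} \<Longrightarrow>
      distinct [i, j, k, l] \<Longrightarrow> commutator (\<sigma> (T a i j)) (\<sigma> (T b k l)) = 0"
    and "r \<in> relators n N"
  shows "subst (gens n N) \<sigma> r = 0"
proof -
  have t: "subst (gens n N) \<sigma> (t a i j) = \<sigma> (T a i j)"
    if "a \<in> residues_mod N" "i \<in> {2..n}" "j \<in> {2..n}" "i \<noteq> j" for a i j
    using that by (intro subst_letter const finite_gens) (auto simp: gens_def)
  have t1: "subst (gens n N) \<sigma> (t1 i) = \<sigma> (T1 i)" if "i \<in> {2..n}" for i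
    using that by (intro subst_letter const finite_gens) (auto simp: gens_def)
  have tsum: "subst (gens n N) \<sigma> (tsum N i j) = (\<Sum>c\<in>residues_mod N. \<sigma> (T c i j))"
    if "i \<in> {2..n}" "j \<in> {2..n}" "i \<noteq> j" for i j
    unfolding tsum_def subst_sum by (intro sum.cong refl t) (use that in auto)
  note simps = subst_diff subst_add t t1 tsum subst_commutator[OF finite_gens const]
  \<comment> \<open>The existence of the residue \<open>a\<close> forces \<open>N > 0\<close>,
    without which \<open>mod\<close> would not land among the residues.\<close>
  have residue: "x mod int N \<in> residues_mod N" if "a \<in> residues_mod N" for a x
    using that by (auto simp: residues_mod_def)
  show ?thesis
    using \<open>r \<in> relators n N\<close>
  proof cases
    case (1 a i j)
    then show ?thesis using R1[of a i j] residue[of a "- a"] by (auto simp: simps)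
  next
    case (2 a b i j k)
    then show ?thesis using R2[of a b i j k] residue[of a "a + b"] by (auto simp: simps)
  next
    case (3 a i j)
    then show ?thesis using R3[of a i j] by (auto simp: simps)
  next
    case (4 i j)
    then show ?thesis using R4[of i j] by (auto simp: simps)
  next
    case (5 a i j k)
    then show ?thesis using R5[of a i j k] by (auto simp: simps)
  next
    case (6 a b i j k l)
    then show ?thesis using R6[of a b i j k l] by (auto simp: simps)
  qed
qed

section \<open>Images of the mixed pentagon\<close>

lemma supported_ev: "supported (insert X (Y ` residues_mod N)) (ev N h X Y)"
  unfolding ev_def
  by (rule supported_subst) (auto simp: gens3_def intro!: supported_letter)

lemma supported_mono: "supported X f \<Longrightarrow> X \<subseteq> Y \<Longrightarrow> supported Y f"
  using lists_mono[of X Y] by (auto simp: supported_def)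

lemma subst_ev:
  assumes "finite Z" "\<And>z. z \<in> Z \<Longrightarrow> coeff (\<phi> z) [] = 0" "X \<in> Z" "Y ` residues_mod N \<subseteq> Z"
  shows "subst Z \<phi> (ev N h X Y) = subst (gens3 N) (case_gen3 (\<phi> X) (\<lambda>a. \<phi> (Y a))) h"
proof -
  have "subst Z \<phi> (ev N h X Y) = subst (gens3 N)
      (\<lambda>s. subst Z \<phi> (case s of A \<Rightarrow> letter X | B a \<Rightarrow> letter (Y a))) h"
    unfolding ev_def
    by (rule subst_subst) (use assms in \<open>auto simp: coeff_letter split: gen3.split\<close>)
  also have "\<dots> = subst (gens3 N) (case_gen3 (\<phi> X) (\<lambda>a. \<phi> (Y a))) h"
    by (rule subst_cong) (use assms in \<open>auto simp: gens3_def subst_letter image_subset_iff\<close>)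
  finally show ?thesis .
qed

text \<open>Any graded assignment that kills the relators turns the equation in the completed
  enveloping algebra into an identity of ordinary series. Both specialisations used below are
  instances.\<close>

lemma mixed_pentagon_image:
  fixes \<sigma> :: "gen \<Rightarrow> ('y, 'k::field_char_0) ncseries" and g h :: "(gen3, 'k) ncseries"
  assumes "N \<ge> 1"
    and linear: "\<And>x. x \<in> gens 4 N \<Longrightarrow> linear_form (\<sigma> x)"
    and rel: "\<And>r. r \<in> relators 4 N \<Longrightarrow> subst (gens 4 N) \<sigma> r = 0"
    and pentagon: "cuea_eq (lie_t0 4 N)
      (ev N h (cls 4 N (t1 2)) (\<lambda>a. cls 4 N (t a 2 3 + t a 2 4))
        * ev N h (cls 4 N (t1 3 + tsum N 2 3)) (\<lambda>a. cls 4 N (t a 3 4)))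
      (ev 1 g (cls 4 N (t 0 2 3)) (\<lambda>_. cls 4 N (t 0 3 4))
        * ev N h (cls 4 N (t1 2 + t1 3 + tsum N 2 3)) (\<lambda>a. cls 4 N (t a 2 4 + t a 3 4))
        * ev N h (cls 4 N (t1 2)) (\<lambda>a. cls 4 N (t a 2 3)))"
  defines "\<Sigma> \<equiv> \<Sum>c\<in>residues_mod N. \<sigma> (T c 2 3)"
  shows "subst (gens3 N) (case_gen3 (\<sigma> (T1 2)) (\<lambda>a. \<sigma> (T a 2 3) + \<sigma> (T a 2 4))) h
      * subst (gens3 N) (case_gen3 (\<sigma> (T1 3) + \<Sigma>) (\<lambda>a. \<sigma> (T a 3 4))) h
    = subst (gens3 1) (case_gen3 (\<sigma> (T 0 2 3)) (\<lambda>_. \<sigma> (T 0 3 4))) g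
      * subst (gens3 N) (case_gen3 (\<sigma> (T1 2) + \<sigma> (T1 3) + \<Sigma>) (\<lambda>a. \<sigma> (T a 2 4) + \<sigma> (T a 3 4))) h
      * subst (gens3 N) (case_gen3 (\<sigma> (T1 2)) (\<lambda>a. \<sigma> (T a 2 3))) h"
proof -
  let ?F = "subst (gens 4 N) \<sigma>"
  define \<phi> where "\<phi> = class_value ?F"
  have const: "coeff (\<sigma> x) [] = 0" if "x \<in> gens 4 N" for x
    using linear[OF that] by (rule linear_form_const)
  have cls: "\<phi> (cls 4 N x) = ?F x" for x
    unfolding \<phi>_def using const rel by (rule class_value_cls)
  have t: "?F (t a i j) = \<sigma> (T a i j)" "linear_form (\<sigma> (T a i j))"
    if "a \<in> residues_mod N" "i \<in> {2..4}" "j \<in> {2..4}" "i \<noteq> j" for a i j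
    using that by (intro subst_letter linear const finite_gens; force simp: gens_def)+
  have t1: "?F (t1 i) = \<sigma> (T1 i)" "linear_form (\<sigma> (T1 i))" if "i \<in> {2..4}" for i
    using that by (intro subst_letter linear const finite_gens; force simp: gens_def)+
  have tsum: "?F (tsum N 2 3) = \<Sigma>" "linear_form \<Sigma>"
    unfolding tsum_def subst_sum \<Sigma>_def by (auto intro!: sum.cong linear_form_sum t)
  note simps = cls subst_add t t1 tsum
  let ?R = "residues_mod N"
  have R: "0 \<in> ?R" "residues_mod 1 = {0}" using \<open>N \<ge> 1\<close> by (auto simp: residues_mod_def)
  let ?C = "cls 4 N :: (gen, 'k) ncseries \<Rightarrow> _"
  let ?a = "?C (t1 2)" and ?b = "\<lambda>a. ?C (t a 2 3 + t a 2 4)"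
  let ?c = "?C (t1 3 + tsum N 2 3)" and ?d = "\<lambda>a. ?C (t a 3 4)"
  let ?e = "?C (t1 2 + t1 3 + tsum N 2 3)" and ?f = "\<lambda>a. ?C (t a 2 4 + t a 3 4)"
  let ?g = "\<lambda>a. ?C (t a 2 3)"
  \<comment> \<open>A finite alphabet containing every argument of the five factors.\<close>
  define Z where "Z = {?a, ?c, ?e} \<union> ?b ` ?R \<union> ?d ` ?R \<union> ?f ` ?R \<union> ?g ` ?R"
  have fin: "finite Z" by (simp add: Z_def)
  have lin: "linear_form (\<phi> z)" if "z \<in> Z" for z
    using that unfolding Z_def by (auto simp: simps)
  then have const': "coeff (\<phi> z) [] = 0" if "z \<in> Z" for z
    using that by (simp add: linear_form_const)
  have supp: "supported Z (ev M k X Y)" if "X \<in> Z" "Y ` residues_mod M \<subseteq> Z" for M k X Y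
    using that by (intro supported_mono[OF supported_ev]) auto
  note eq = subst_class_value_eq[OF _ _ pentagon, where \<sigma> = \<sigma> and X = Z, folded \<phi>_def]
  have mem: "?a \<in> Z" "?c \<in> Z" "?e \<in> Z" "?g 0 \<in> Z" "?b ` ?R \<subseteq> Z" "?d ` ?R \<subseteq> Z" "?f ` ?R \<subseteq> Z" "?g ` ?R \<subseteq> Z"
    "(\<lambda>_. ?d 0) ` residues_mod 1 \<subseteq> Z"
    using R by (auto simp: Z_def)
  have "subst (gens3 N) (case_gen3 (\<phi> ?a) (\<lambda>a. \<phi> (?b a))) h
      * subst (gens3 N) (case_gen3 (\<phi> ?c) (\<lambda>a. \<phi> (?d a))) h
    = subst (gens3 1) (case_gen3 (\<phi> (?g 0)) (\<lambda>_. \<phi> (?d 0))) g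
      * subst (gens3 N) (case_gen3 (\<phi> ?e) (\<lambda>a. \<phi> (?f a))) h
      * subst (gens3 N) (case_gen3 (\<phi> ?a) (\<lambda>a. \<phi> (?g a))) h"
    using eq[OF const rel fin lin supported_mult supported_mult[OF supported_mult]]
    by (simp add: supp mem subst_mult[OF fin const'] subst_ev[OF fin const'] del: One_nat_def)
  \<comment> \<open>Values on cosets are replaced by values of \<open>\<sigma>\<close> on
    generators. This is legitimate for residues \<open>a\<close> only, hence the passage through
    \<open>subst_cong\<close>.\<close>
  also have "subst (gens3 N) (case_gen3 (\<phi> ?a) (\<lambda>a. \<phi> (?b a))) h
      = subst (gens3 N) (case_gen3 (\<sigma> (T1 2)) (\<lambda>a. \<sigma> (T a 2 3) + \<sigma> (T a 2 4))) h"
    by (rule subst_cong) (auto simp: gens3_def simps)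
  also have "subst (gens3 N) (case_gen3 (\<phi> ?c) (\<lambda>a. \<phi> (?d a))) h
      = subst (gens3 N) (case_gen3 (\<sigma> (T1 3) + \<Sigma>) (\<lambda>a. \<sigma> (T a 3 4))) h"
    by (rule subst_cong) (auto simp: gens3_def simps)
  also have "subst (gens3 1) (case_gen3 (\<phi> (?g 0)) (\<lambda>_. \<phi> (?d 0))) g
      = subst (gens3 1) (case_gen3 (\<sigma> (T 0 2 3)) (\<lambda>_. \<sigma> (T 0 3 4))) g"
    by (rule subst_cong) (use R in \<open>auto simp: gens3_def simps\<close>)
  also have "subst (gens3 N) (case_gen3 (\<phi> ?e) (\<lambda>a. \<phi> (?f a))) h
      = subst (gens3 N) (case_gen3 (\<sigma> (T1 2) + \<sigma> (T1 3) + \<Sigma>) (\<lambda>a. \<sigma> (T a 2 4) + \<sigma> (T a 3 4))) h"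
    by (rule subst_cong) (auto simp: gens3_def simps)
  also have "subst (gens3 N) (case_gen3 (\<phi> ?a) (\<lambda>a. \<phi> (?g a))) h
      = subst (gens3 N) (case_gen3 (\<sigma> (T1 2)) (\<lambda>a. \<sigma> (T a 2 3))) h"
    by (rule subst_cong) (auto simp: gens3_def simps)
  finally show ?thesis .
qed

section \<open>The distribution relation\<close>

text \<open>The assignment reduces the pentagon to h(A|0) h(0|0) = g(0,0) h(A|0) h(A|0). All
  constant terms are 1, so comparing coefficients at \<open>[A]\<close> gives
  \<open>c = c + c\<close> for \<open>c = coeff h [A]\<close>.\<close>

lemma coeff_A_eq_0:
  fixes g h :: "(gen3, 'k::field_char_0) ncseries"
  assumes "N \<ge> 1" "g \<in> exp_t03 1" "h \<in> exp_t03 N"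
    and pentagon: "cuea_eq (lie_t0 4 N)
      (ev N h (cls 4 N (t1 2)) (\<lambda>a. cls 4 N (t a 2 3 + t a 2 4))
        * ev N h (cls 4 N (t1 3 + tsum N 2 3)) (\<lambda>a. cls 4 N (t a 3 4)))
      (ev 1 g (cls 4 N (t 0 2 3)) (\<lambda>_. cls 4 N (t 0 3 4))
        * ev N h (cls 4 N (t1 2 + t1 3 + tsum N 2 3)) (\<lambda>a. cls 4 N (t a 2 4 + t a 3 4))
        * ev N h (cls 4 N (t1 2)) (\<lambda>a. cls 4 N (t a 2 3)))"
  shows "coeff h [A] = 0"
proof -
  define \<sigma> :: "gen \<Rightarrow> (gen3, 'k) ncseries" where "\<sigma> x = (if x = T1 2 then letter A else 0)" for x
  have \<sigma>: "\<sigma> (T a i j) = 0" "\<sigma> (T1 i) = (if i = 2 then letter A else 0)" for a i j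
    by (simp_all add: \<sigma>_def)
  have linear: "linear_form (\<sigma> x)" for x by (simp add: \<sigma>_def)
  \<comment> \<open>Every bracket in a relator has an entry sent to 0.\<close>
  have rel: "subst (gens 4 N) \<sigma> r = 0" if "r \<in> relators 4 N" for r
    by (rule subst_relator[OF _ _ _ _ _ _ _ that]) (auto simp: \<sigma> linear linear_form_const)
  let ?S = "\<lambda>N f. subst (gens3 N) (case_gen3 (letter A) (\<lambda>_. 0)) f :: (gen3, 'k) ncseries"
  let ?Z = "\<lambda>N f. subst (gens3 N) (case_gen3 0 (\<lambda>_. 0)) f :: (gen3, 'k) ncseries"
  have "?S N h * ?Z N h = ?Z 1 g * ?S N h * ?S N h"
    using mixed_pentagon_image[OF \<open>N \<ge> 1\<close> linear rel pentagon] by (simp add: \<sigma>)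
  then have "coeff (?S N h * ?Z N h) [A] = coeff (?Z 1 g * ?S N h * ?S N h) [A]" by simp
  moreover have "coeff (?S N h) [A] = coeff h [A]"
    by (simp add: coeff_subst_singleton sum_gens3 coeff_letter)
  moreover have "coeff (?Z N f) [A] = 0" for N f
    by (simp add: coeff_subst_singleton sum_gens3)
  moreover have "coeff g [] = 1" "coeff h [] = 1"
    using assms(2,3) by (simp_all add: exp_t03_def exp_free_lie_def)
  ultimately show ?thesis
    by (simp add: coeff_mult_singleton del: One_nat_def)
qed

text \<open>
  The morphism \<open>t\<^sup>1\<^sup>i \<mapsto> 0\<close>, \<open>t(a)\<^sup>i\<^sup>j \<mapsto> t\<^sup>i\<^sup>j\<close> or \<open>0\<close> according as \<open>a \<in> E\<close> or not, followed by the
  quotient by the central element \<open>t\<^sup>2\<^sup>3 + t\<^sup>2\<^sup>4 + t\<^sup>3\<^sup>4\<close>.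
\<close>

fun to_t03 :: "int set \<Rightarrow> gen \<Rightarrow> (gen3, 'k::field_char_0) ncseries" where
  "to_t03 E (T1 i) = 0"
| "to_t03 E (T a i j) = (if a \<notin> E then 0
    else if {i, j} = {2, 3} then letter A
    else if {i, j} = {3, 4} then letter (B 0)
    else if {i, j} = {2, 4} then - letter A - letter (B 0)
    else 0)"

lemma linear_form_to_t03: "linear_form (to_t03 E x)"
  by (cases x) auto

lemma commutator_minus_self [simp]: "commutator x (- x) = 0"
  by (simp add: commutator_def)

lemma commutator_scale_self [simp]: "commutator (scale c x) x = 0"
  by (simp add: commutator_def scale_mult_left scale_mult_right)

text \<open>\<open>neg\<close> and \<open>add\<close> say that membership in \<open>E\<close> is
  invariant under negation and under translation by elements of \<open>E\<close>, as for a subgroup.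
  The brackets whose entries both survive pair an image with a multiple of itself.\<close>

lemma to_t03_relator:
  fixes r :: "(gen, 'k::field_char_0) ncseries"
  assumes neg: "\<And>a. a \<in> residues_mod N \<Longrightarrow> (- a) mod int N \<in> E \<longleftrightarrow> a \<in> E"
    and add: "\<And>a b. a \<in> E \<Longrightarrow> a \<in> residues_mod N \<Longrightarrow> b \<in> residues_mod N \<Longrightarrow>
      (a + b) mod int N \<in> E \<longleftrightarrow> b \<in> E"
    and "r \<in> relators 4 N"
  shows "subst (gens 4 N) (to_t03 E :: gen \<Rightarrow> (gen3, 'k) ncseries) r = 0"
proof -
  let ?\<sigma> = "to_t03 E :: gen \<Rightarrow> (gen3, 'k) ncseries"
  show ?thesis
  proof (rule subst_relator[OF _ _ _ _ _ _ _ assms(3)])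
    show "coeff (?\<sigma> x) [] = 0" for x
      by (simp add: linear_form_to_t03 linear_form_const)
    show "?\<sigma> (T a i j) = ?\<sigma> (T (- a mod int N) j i)"
      if "a \<in> residues_mod N" for a i j
      using neg[OF that] by (simp add: insert_commute)
    show "commutator (?\<sigma> (T a i j))
        (?\<sigma> (T ((a + b) mod int N) i k) + ?\<sigma> (T b j k)) = 0"
      if "a \<in> residues_mod N" "b \<in> residues_mod N" "{i, j, k} \<subseteq> {2..4}" "distinct [i, j, k]" for a b i j k
    proof (cases "a \<in> E \<and> b \<in> E")
      case True
      have "i \<in> {2, 3, 4}" "j \<in> {2, 3, 4}" "k \<in> {2, 3, 4}" using that(3) by auto
      \<comment> \<open>\<open>i\<close>, \<open>j\<close>, \<open>k\<close> are 2, 3, 4 in some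
        order, and the images of the three generators attached to the pairs of indices add up to
        0.\<close>
      then have "?\<sigma> (T b i k) + ?\<sigma> (T b j k) = - ?\<sigma> (T a i j)"
        using True that(4) by (auto simp: doubleton_eq_iff)
      moreover have "?\<sigma> (T ((a + b) mod int N) i k) = ?\<sigma> (T b i k)"
        using True add[OF _ that(1,2)] by simp
      ultimately show ?thesis by (simp only: commutator_minus_self)
    \<comment> \<open>If \<open>a\<close> is outside \<open>E\<close>, the first entry is 0;
      otherwise \<open>b\<close> and \<open>a + b\<close> both lie outside \<open>E\<close> and the
      second entry is 0.\<close>
    qed (use add[OF _ that(1,2)] in auto)
    show "commutator (?\<sigma> (T1 i) + ?\<sigma> (T1 j) + (\<Sum>c\<in>residues_mod N. ?\<sigma> (T c i j)))
        (?\<sigma> (T a i j)) = 0" for a i j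
    proof (cases "a \<in> E")
      case True
      \<comment> \<open>The image of \<open>T c i j\<close> is the same for all \<open>c\<close> in
        \<open>E\<close>, so the sum is a multiple of it.\<close>
      have "(\<Sum>c\<in>residues_mod N. ?\<sigma> (T c i j))
          = (\<Sum>c\<in>residues_mod N. if c \<in> E then ?\<sigma> (T a i j) else 0)"
        using True by (intro sum.cong) auto
      then show ?thesis
        by (simp only: sum_if_const_eq_scale finite_residues_mod to_t03.simps(1) add_0_left commutator_scale_self)
    qed simp
    \<comment> \<open>Only three indices are available, so four distinct ones cannot occur.\<close>
    show "commutator (?\<sigma> (T a i j)) (?\<sigma> (T b k l)) = 0"
      if "{i, j, k, l} \<subseteq> {2..4}" "distinct [i, j, k, l]" for a b i j k l
      using card_mono[OF _ that(1)] that(2) by simp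
  qed simp_all
qed

text \<open>The series h_E of the overview. When \<open>E\<close> consists of residues, the
  multiplicity \<open>card E\<close> of \<open>A\<close> is that of the image of
  \<open>tsum N 2 3\<close>, which has one term \<open>A\<close> for each element of
  \<open>E\<close>.\<close>

definition fold_residues :: "nat \<Rightarrow> int set \<Rightarrow> (gen3, 'k::field_char_0) ncseries \<Rightarrow> (gen3, 'k) ncseries" where
  "fold_residues N E = subst (gens3 N)
    (case_gen3 (scale (of_nat (card E)) (letter A)) (\<lambda>a. if a \<in> E then letter (B 0) else 0))"

text \<open>The specialised equation reads e^{-cB} h_E = g e^{-cA} e^{cA}, with c the sum in the
  conclusion. The exponentials in \<open>A\<close> cancel, and the remaining one moves to the other
  side.\<close>

lemma fold_residues_eq:
  fixes g h :: "(gen3, 'k::field_char_0) ncseries"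
  assumes "N \<ge> 1" "g \<in> exp_t03 1" "h \<in> exp_t03 N"
    and pentagon: "cuea_eq (lie_t0 4 N)
      (ev N h (cls 4 N (t1 2)) (\<lambda>a. cls 4 N (t a 2 3 + t a 2 4))
        * ev N h (cls 4 N (t1 3 + tsum N 2 3)) (\<lambda>a. cls 4 N (t a 3 4)))
      (ev 1 g (cls 4 N (t 0 2 3)) (\<lambda>_. cls 4 N (t 0 3 4))
        * ev N h (cls 4 N (t1 2 + t1 3 + tsum N 2 3)) (\<lambda>a. cls 4 N (t a 2 4 + t a 3 4))
        * ev N h (cls 4 N (t1 2)) (\<lambda>a. cls 4 N (t a 2 3)))"
    and E: "0 \<in> E" "E \<subseteq> residues_mod N"
    and neg: "\<And>a. a \<in> residues_mod N \<Longrightarrow> (- a) mod int N \<in> E \<longleftrightarrow> a \<in> E"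
    and add: "\<And>a b. a \<in> E \<Longrightarrow> a \<in> residues_mod N \<Longrightarrow> b \<in> residues_mod N \<Longrightarrow>
      (a + b) mod int N \<in> E \<longleftrightarrow> b \<in> E"
  shows "fold_residues N E h = ncexp (scale (\<Sum>a\<in>E. coeff h [B a]) (letter (B 0))) * g"
proof -
  let ?c = "\<Sum>a\<in>E. coeff h [B a]"
  let ?A = "letter A :: (gen3, 'k) ncseries" and ?B = "letter (B 0) :: (gen3, 'k) ncseries"
  have hA: "coeff h [A] = 0" by (rule coeff_A_eq_0[OF assms(1-4)])
  have h: "h \<in> exp_free_lie (gens3 N)" using assms(3) by (simp add: exp_t03_def)
  \<comment> \<open>\<open>m\<close> disappears from the exponent because \<open>h\<close> has no
    linear term in \<open>A\<close>.\<close>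
  have exp: "subst (gens3 N) (case_gen3 (scale m (letter y)) (\<lambda>a. if a \<in> E then scale e (letter y) else 0)) h
      = ncexp (scale (e * ?c) (letter y))" for m e and y :: gen3
  proof -
    let ?w = "case_gen3 m (\<lambda>a. if a \<in> E then e else 0)"
    have "subst (gens3 N) (case_gen3 (scale m (letter y)) (\<lambda>a. if a \<in> E then scale e (letter y) else 0)) h
        = subst (gens3 N) (\<lambda>x. scale (?w x) (letter y)) h"
      by (rule subst_cong) (auto split: gen3.split)
    also have "\<dots> = ncexp (scale (\<Sum>x\<in>gens3 N. ?w x * coeff h [x]) (letter y))"
      by (rule subst_group_like_scaled_letter[OF h finite_gens3])
    also have "(\<Sum>x\<in>gens3 N. ?w x * coeff h [x])
        = (\<Sum>a\<in>residues_mod N. if a \<in> E then e * coeff h [B a] else 0)"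
      unfolding sum_gens3 by (auto simp: hA intro!: sum.cong)
    also have "\<dots> = (\<Sum>a\<in>E. e * coeff h [B a])"
      using E(2) by (simp add: sum.If_cases Int_absorb1)
    finally show ?thesis by (simp add: sum_distrib_left)
  qed
  have "(\<Sum>c\<in>residues_mod N. to_t03 E (T c 2 3)) = scale (of_nat (card E)) ?A"
  proof -
    have "(\<Sum>c\<in>residues_mod N. to_t03 E (T c 2 3)) = (\<Sum>c\<in>residues_mod N. if c \<in> E then ?A else 0)"
      by (intro sum.cong) auto
    then show ?thesis using E(2) by (simp add: sum_if_const_eq_scale Int_absorb1)
  qed
  note image = mixed_pentagon_image[OF \<open>N \<ge> 1\<close> linear_form_to_t03 to_t03_relator pentagon,
      of E, OF neg add, unfolded this]
  \<comment> \<open>Arguments are written as explicit multiples of a single letter, with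
    coefficients such as 0, 1 and -1, so that \<open>exp\<close> applies to three of the
    factors.\<close>
  have "subst (gens3 N) (case_gen3 (scale 0 ?B) (\<lambda>a. if a \<in> E then scale (-1) ?B else 0)) h
      * fold_residues N E h
    = subst (gens3 1) (case_gen3 ?A (\<lambda>_. ?B)) g
      * subst (gens3 N) (case_gen3 (scale (of_nat (card E)) ?A) (\<lambda>a. if a \<in> E then scale (-1) ?A else 0)) h
      * subst (gens3 N) (case_gen3 (scale 0 ?A) (\<lambda>a. if a \<in> E then scale 1 ?A else 0)) h"
  proof -
    have
      "(\<lambda>a. to_t03 E (T a 2 3) + to_t03 E (T a 2 4)) = (\<lambda>a. if a \<in> E then scale (-1) ?B else 0)"
      "(\<lambda>a. to_t03 E (T a 3 4)) = (\<lambda>a. if a \<in> E then ?B else 0)"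
      "(\<lambda>a. to_t03 E (T a 2 4) + to_t03 E (T a 3 4)) = (\<lambda>a. if a \<in> E then scale (-1) ?A else 0)"
      "(\<lambda>a. to_t03 E (T a 2 3)) = (\<lambda>a. if a \<in> E then scale 1 ?A else 0)"
      "to_t03 E (T 0 2 3) = ?A" "to_t03 E (T 0 3 4) = ?B"
      by (auto simp: fun_eq_iff doubleton_eq_iff scale_minus_1 E(1))
    then show ?thesis using image
      by (simp only: to_t03.simps(1) add_0_left fold_residues_def scale_0)
  qed
  \<comment> \<open>The alphabet of \<open>g\<close> has \<open>B 0\<close> as its only letter
    besides \<open>A\<close>.\<close>
  also have "subst (gens3 1) (case_gen3 ?A (\<lambda>_. ?B)) g = subst (gens3 1) letter g"
  proof (rule subst_cong)
    have "residues_mod 1 = {0}" by (auto simp: residues_mod_def)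
    then show "case_gen3 ?A (\<lambda>_. ?B) x = letter x" if "x \<in> gens3 1" for x
      using that by (auto simp: gens3_def)
  qed
  also have "\<dots> = g"
    using assms(2) by (intro subst_letters_id) (auto simp: exp_t03_def exp_free_lie_def supported_def)
  finally have "ncexp (scale (- ?c) ?B) * fold_residues N E h = g * (ncexp (scale (- ?c) ?A) * ncexp (scale ?c ?A))"
    unfolding exp by (simp add: mult.assoc)
  also have "\<dots> = g" by (simp add: ncexp_scale_letter_mult)
  finally have "ncexp (scale ?c ?B) * (ncexp (scale (- ?c) ?B) * fold_residues N E h) = ncexp (scale ?c ?B) * g"
    by simp
  then show ?thesis by (simp add: mult.assoc[symmetric] ncexp_scale_letter_mult)
qed

theorem theorem0p1:
  fixes N :: nat
    and g h :: "(gen3, 'k::field_char_0) ncseries"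
  assumes "N \<ge> 1"
    and "g \<in> exp_t03 1"
    and "h \<in> exp_t03 N"
    and mixed_pentagon: "cuea_eq (lie_t0 4 N)
      (ev N h (cls 4 N (t1 2)) (\<lambda>a. cls 4 N (t a 2 3 + t a 2 4))
        * ev N h (cls 4 N (t1 3 + tsum N 2 3)) (\<lambda>a. cls 4 N (t a 3 4)))
      (ev 1 g (cls 4 N (t 0 2 3)) (\<lambda>_. cls 4 N (t 0 3 4))
        * ev N h (cls 4 N (t1 2 + t1 3 + tsum N 2 3)) (\<lambda>a. cls 4 N (t a 2 4 + t a 3 4))
        * ev N h (cls 4 N (t1 2)) (\<lambda>a. cls 4 N (t a 2 3)))"
  shows "pi_N1 N h = ncexp (scale (rho_N1 N h) (letter (B 0))) * delta_N1 N h"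
proof -
  let ?R = "residues_mod N"
  let ?c = "\<Sum>a\<in>?R. coeff h [B a]" and ?d = "coeff h [B 0]"
  let ?e = "\<lambda>c. ncexp (scale c (letter (B 0))) :: (gen3, 'k) ncseries"
  have R: "0 \<in> ?R" "x mod int N \<in> ?R" for x
    using \<open>N \<ge> 1\<close> by (auto simp: residues_mod_def)
  \<comment> \<open>The whole group has \<open>N\<close> elements, which matches the factor of
    \<open>A\<close> in \<open>pi_N1\<close>.\<close>
  have "pi_N1 N h = fold_residues N ?R h"
    unfolding pi_N1_def fold_residues_def
    by (rule subst_cong) (auto simp: gens3_def residues_mod_def)
  also have "\<dots> = ?e ?c * g"
    by (rule fold_residues_eq[OF assms]) (use R in auto)
  finally have pi: "pi_N1 N h = ?e ?c * g" .
  \<comment> \<open>The trivial subgroup has one element, so \<open>A\<close> keeps coefficient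
    1.\<close>
  have "delta_N1 N h = fold_residues N {0} h"
    unfolding delta_N1_def fold_residues_def
    by (rule subst_cong) (auto simp: gens3_def)
  also have "\<dots> = ?e (\<Sum>a\<in>{0}. coeff h [B a]) * g"
  proof (rule fold_residues_eq[OF assms])
    show "(- a) mod int N \<in> {0} \<longleftrightarrow> a \<in> {0}" if "a \<in> ?R" for a
      using that by (auto simp: residues_mod_def zmod_zminus1_eq_if split: if_splits)
  qed (use R in \<open>auto simp: residues_mod_def\<close>)
  finally have delta: "delta_N1 N h = ?e ?d * g" by simp
  \<comment> \<open>Only the letters \<open>B a\<close> contribute, each with weight 1; hence
    \<open>rho_N1 N h\<close> is the difference of the exponents found for the two
    subgroups.\<close>
  have "coeff (pi_N1 N h) [B 0] = ?c"
    unfolding pi_N1_def by (simp add: coeff_subst_singleton sum_gens3 coeff_letter)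
  then have "?e (rho_N1 N h) * delta_N1 N h = ?e ?c * g"
    unfolding delta mult.assoc[symmetric] ncexp_scale_letter_mult rho_N1_def by simp
  then show ?thesis by (simp add: pi)
qed

end
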